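(* Let $M\subseteq S_d(\mathbf{X},(\infty,\mathbf{a}))$ be a multicomplex. Then there exists a multicomplex $M'\subseteq S_d(\mathbf{X},(\infty,\mathbf{a}))$ such that $M'$ is $(0)$-compressed and $F(M')=F(M)$.
   Context: Let $\mathbf{X}_0,\mathbf{X}_1,\ldots,\mathbf{X}_m$ be pairwise disjoint finite sets of variables, $\mathbf{X}=\bigcup_{i=0}^m\mathbf{X}_i$, $\mathbf{a}=(a_1,\ldots,a_m)$ an integer vector and $d$ a nonnegative integer. For a monomial $\mu$ on $\mathbf{X}$ and $Y\subseteq\mathbf{X}$, $\mu_Y$ is the part of $\mu$ supported in $Y$. $S_d(\mathbf{X},(\infty,\mathbf{a}))$ is the set of monomials $\mu$ on $\mathbf{X}$ with $\deg\mu\le d$ and $\deg\mu_{\mathbf{X}_i}\le a_i$ for $1\le i\le m$. A multicomplex is a set of monomials closed under divisibility; its $F$-vector is $(F_0,F_1,\ldots)$, $F_j$ = number of its monomials of degree $j$. Fix a total order $\succ$ on $\mathbf{X}$ with $x\succ y$ whenever $x\in\mathbf{X}_i$, $y\in\mathbf{X}_j$, $i<j$; revlex order on monomials of equal degree: $\mu_1\succ\mu_2$ if the $\succ$-least variable in $\mu_1/\mu_2$ has negative exponent. A multicomplex $M\subseteq S_d(\mathbf{X},(\infty,\mathbf{a}))$ is $(0,i)$-compressed ($1\le i\le m$) if whenever $\mu\in M$ and $\mu'$ is a monomial on $\mathbf{X}$ with $\deg\mu'=\deg\mu$, $\mu'_{\mathbf{X}-(\mathbf{X}_0\cup\mathbf{X}_i)}=\mu_{\mathbf{X}-(\mathbf{X}_0\cup\mathbf{X}_i)}$,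 and $\mu'_{\mathbf{X}_0\cup\mathbf{X}_i}\succ\mu_{\mathbf{X}_0\cup\mathbf{X}_i}$, then $\mu'\in M$; it is $(0)$-compressed if it is $(0,i)$-compressed for all $1\le i\le m$.
   Formalization: In the definition of (0,i)-compressed, μ' ranges over S_d(X,(∞,a)) instead of all monomials on X; with all monomials the claim fails, e.g. X_0={x}, X_1={y1≻y2}, a_1=1, d=2, M=S_d, where y1² ≻ x·y2 but y1² is not in S_d. *)

theory Defs
  imports "HOL-Library.Multiset" "HOL-Library.Disjoint_Sets"
begin

text \<open>Monomials are finite multisets of variables: the exponent of \<open>x\<close> in \<open>\<mu>\<close> is
  \<open>count \<mu> x\<close>, the degree of \<open>\<mu>\<close> is \<open>size \<mu>\<close>, and \<open>\<nu>\<close> divides \<open>\<mu>\<close> iff \<open>\<nu> \<subseteq># \<mu>\<close>.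
  The variable sets are \<open>X 0, \<dots>, X m\<close>; values of \<open>X\<close> beyond \<open>m\<close>, and of \<open>a\<close> outside
  \<open>{1..m}\<close>, are irrelevant.\<close>

definition part_mon :: "'v set \<Rightarrow> 'v multiset \<Rightarrow> 'v multiset" where
  "part_mon Y \<mu> = filter_mset (\<lambda>x. x \<in> Y) \<mu>"

definition all_vars :: "nat \<Rightarrow> (nat \<Rightarrow> 'v set) \<Rightarrow> 'v set" where
  "all_vars m X = (\<Union>i\<in>{0..m}. X i)"

text \<open>The set $S_d(X,(\infty,a))$.\<close>

definition S_mon :: "nat \<Rightarrow> nat \<Rightarrow> (nat \<Rightarrow> 'v set) \<Rightarrow> (nat \<Rightarrow> int) \<Rightarrow> 'v multiset set" where
  "S_mon d m X a =
     {\<mu>. set_mset \<mu> \<subseteq> all_vars m X \<and> size \<mu> \<le> d \<and>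
         (\<forall>i\<in>{1..m}. int (size (part_mon (X i) \<mu>)) \<le> a i)}"

definition multicomplex :: "'v multiset set \<Rightarrow> bool" where
  "multicomplex M \<longleftrightarrow> (\<forall>\<mu>\<in>M. \<forall>\<nu>. \<nu> \<subseteq># \<mu> \<longrightarrow> \<nu> \<in> M)"

definition F_vector :: "'v multiset set \<Rightarrow> nat \<Rightarrow> nat" where
  "F_vector M j = card {\<mu> \<in> M. size \<mu> = j}"

text \<open>\<open>gt x y\<close> stands for $x \succ y$ on variables. The witness \<open>x\<close> is the \<open>gt\<close>-least
  variable occurring with nonzero exponent in $\mu_1/\mu_2$; that exponent is negative.\<close>

definition revlex_gt ::
  "('v \<Rightarrow> 'v \<Rightarrow> bool) \<Rightarrow> 'v multiset \<Rightarrow> 'v multiset \<Rightarrow> bool" where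
  "revlex_gt gt \<mu>1 \<mu>2 \<longleftrightarrow>
     size \<mu>1 = size \<mu>2 \<and>
     (\<exists>x. count \<mu>1 x < count \<mu>2 x \<and>
          (\<forall>y. y \<noteq> x \<longrightarrow> count \<mu>1 y \<noteq> count \<mu>2 y \<longrightarrow> gt y x))"

text \<open>Compression is relative to the ambient set \<open>S_mon d m X a\<close>: the monomial \<open>\<mu>'\<close> ranges
  over that set, not over all monomials in the variables. The unrestricted condition could
  force monomials outside \<open>S_mon d m X a\<close> into \<open>M\<close>: for \<open>X 0 = {x}\<close>, \<open>X 1 = {y1, y2}\<close>
  with \<open>gt y1 y2\<close>, \<open>a 1 = 1\<close> and \<open>d = 2\<close>, the monomial $y_1^2$ is revlex greater than
  $x y_2$ but is not in \<open>S_mon d m X a\<close>.\<close>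

definition compressed_0i ::
  "nat \<Rightarrow> nat \<Rightarrow> (nat \<Rightarrow> 'v set) \<Rightarrow> (nat \<Rightarrow> int) \<Rightarrow> ('v \<Rightarrow> 'v \<Rightarrow> bool)
     \<Rightarrow> nat \<Rightarrow> 'v multiset set \<Rightarrow> bool" where
  "compressed_0i d m X a gt i M \<longleftrightarrow>
     (\<forall>\<mu>\<in>M. \<forall>\<mu>'\<in>S_mon d m X a.
        size \<mu>' = size \<mu> \<longrightarrow>
        part_mon (all_vars m X - (X 0 \<union> X i)) \<mu>' = part_mon (all_vars m X - (X 0 \<union> X i)) \<mu> \<longrightarrow>
        revlex_gt gt (part_mon (X 0 \<union> X i) \<mu>') (part_mon (X 0 \<union> X i) \<mu>) \<longrightarrow>
        \<mu>' \<in> M)"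

definition compressed_0 ::
  "nat \<Rightarrow> nat \<Rightarrow> (nat \<Rightarrow> 'v set) \<Rightarrow> (nat \<Rightarrow> int) \<Rightarrow> ('v \<Rightarrow> 'v \<Rightarrow> bool)
     \<Rightarrow> 'v multiset set \<Rightarrow> bool" where
  "compressed_0 d m X a gt M \<longleftrightarrow> (\<forall>i\<in>{1..m}. compressed_0i d m X a gt i M)"

end

theory Submission
  imports Defs
begin

text \<open>Compressing \<open>M\<close> on a set \<open>W\<close> of variables replaces, for every fixed part outside \<open>W\<close>, the
  fiber over it by initial revlex segments of the same sizes. If the fibers of the ambient set are
  Macaulay (these segments again form a multicomplex) and are nested as initial segments, the
  result is a multicomplex with the same \<open>F\<close>-vector, and the sum of the revlex ranks drops unless
  nothing changes. Hence compressing repeatedly on \<open>X 0 \<union> X i\<close>, \<open>1 \<le> i \<le> m\<close>, ends in a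
  \<open>(0)\<close>-compressed multicomplex.

  That the fibers are Macaulay follows by adding the variables one at a time, from the least one
  upwards. When a new greatest variable \<open>x\<close> is added to variables \<open>V\<close>, one may compress on \<open>V\<close>
  and on all pairs \<open>{x, y}\<close> with \<open>y \<in> V\<close>. Then the lower shadow of a degree component is obtained
  by dividing by \<open>x\<close> alone, and comparing it with the shadow of an initial segment only requires
  counting monomials free of \<open>x\<close>.\<close>

section \<open>Parts and fibers\<close>

lemma part_mon_simps [simp]:
  "part_mon W {#} = {#}"
  "part_mon W (\<mu> + \<nu>) = part_mon W \<mu> + part_mon W \<nu>"
  "part_mon W (\<mu> - \<nu>) = part_mon W \<mu> - part_mon W \<nu>"
  "set_mset (part_mon W \<mu>) = set_mset \<mu> \<inter> W"
  "part_mon W (add_mset x \<mu>) = (if x \<in> W then add_mset x (part_mon W \<mu>) else part_mon W \<mu>)"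
  "count (part_mon W \<mu>) y = (if y \<in> W then count \<mu> y else 0)"
  by (auto simp: part_mon_def)

lemma part_mon_id: "set_mset \<mu> \<subseteq> W \<Longrightarrow> part_mon W \<mu> = \<mu>"
  by (rule multiset_eqI) (auto simp: not_in_iff[symmetric])

lemma part_mon_disjoint: "set_mset \<mu> \<inter> W = {} \<Longrightarrow> part_mon W \<mu> = {#}"
  by (metis part_mon_simps(4) set_mset_eq_empty_iff)

lemma part_mon_partition: "part_mon W \<mu> + part_mon (-W) \<mu> = \<mu>"
  by (rule multiset_eqI) auto

lemma part_mon_mono: "\<nu> \<subseteq># \<mu> \<Longrightarrow> part_mon W \<nu> \<subseteq># part_mon W \<mu>"
  by (auto simp: part_mon_def intro: multiset_filter_mono)

lemma size_part_mon_partition: "size (part_mon W \<mu>) + size (part_mon (-W) \<mu>) = size \<mu>"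
  by (metis part_mon_partition size_union)

lemma size_part_mon_le: "size \<mu> \<le> d \<Longrightarrow> size (part_mon W \<mu>) \<le> d"
  by (metis add_leD1 size_part_mon_partition)

text \<open>Every divisor is reached by cancelling the cofactor one variable at a time.\<close>

lemma multicomplexI_remove1:
  assumes "\<And>\<mu> z. \<mu> \<in> M \<Longrightarrow> z \<in># \<mu> \<Longrightarrow> \<mu> - {#z#} \<in> M"
  shows "multicomplex M"
proof -
  have "\<nu> + \<rho> \<in> M \<Longrightarrow> \<nu> \<in> M" for \<nu> \<rho>
  proof (induction \<rho>)
    case (add z \<rho>)
    then show ?case using assms[of "\<nu> + add_mset z \<rho>" z] by simp
  qed simp
  then show ?thesis
    unfolding multicomplex_def by (metis subset_mset.add_diff_inverse)
qed

lemma multicomplexD: "multicomplex M \<Longrightarrow> \<mu> \<in> M \<Longrightarrow> \<nu> \<subseteq># \<mu> \<Longrightarrow> \<nu> \<in> M"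
  unfolding multicomplex_def by blast

lemma F_vector_mono: "finite B \<Longrightarrow> A \<subseteq> B \<Longrightarrow> F_vector A k \<le> F_vector B k"
  unfolding F_vector_def by (intro card_mono) auto

lemma revlex_gt_add_right [simp]:
  "revlex_gt gt (\<mu> + \<rho>) (\<nu> + \<rho>) \<longleftrightarrow> revlex_gt gt \<mu> \<nu>"
  by (simp add: revlex_gt_def)

lemma revlex_gt_size: "revlex_gt gt \<mu> \<nu> \<Longrightarrow> size \<mu> = size \<nu>"
  by (simp add: revlex_gt_def)

text \<open>Only the factor supported in \<open>W\<close> is stored, not the whole product, so that
  fibers over different \<open>\<nu>\<close> live in one set and can be compared by
  inclusion.\<close>

definition fiber :: "'v set \<Rightarrow> 'v multiset set \<Rightarrow> 'v multiset \<Rightarrow> 'v multiset set" where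
  "fiber W D \<nu> = {\<eta>. set_mset \<eta> \<subseteq> W \<and> \<eta> + \<nu> \<in> D}"

lemma finite_fiber: "finite D \<Longrightarrow> finite (fiber W D \<nu>)"
  by (rule inj_on_finite[where f = "\<lambda>\<eta>. \<eta> + \<nu>" and B = D])
     (auto simp: fiber_def inj_on_def)

lemma multicomplex_fiber: "multicomplex D \<Longrightarrow> multicomplex (fiber W D \<nu>)"
  unfolding multicomplex_def fiber_def
proof clarify
  fix \<mu> \<eta> assume *: "\<forall>\<mu>\<in>D. \<forall>\<eta>. \<eta> \<subseteq># \<mu> \<longrightarrow> \<eta> \<in> D" "\<mu> + \<nu> \<in> D" "set_mset \<mu> \<subseteq> W" "\<eta> \<subseteq># \<mu>"
  then have "\<eta> + \<nu> \<subseteq># \<mu> + \<nu>" by simp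
  with * show "set_mset \<eta> \<subseteq> W \<and> \<eta> + \<nu> \<in> D"
    using set_mset_mono[of \<eta> \<mu>] by blast
qed

text \<open>For \<open>\<nu>\<close> free of \<open>W\<close>, multiplying by \<open>\<nu>\<close>
  and taking the \<open>W\<close>-part are mutually inverse. This turns equal
  \<open>F\<close>-vectors of fibers into equal counts of whole monomials.\<close>

lemma card_fiber_slice:
  assumes "part_mon W \<nu> = {#}"
  shows "card {\<mu> \<in> M. (part_mon (-W) \<mu>, size (part_mon W \<mu>)) = (\<nu>, k)} =
         F_vector (fiber W M \<nu>) k"
proof -
  have nu: "part_mon (-W) \<nu> = \<nu>"
    using assms by (metis add_0 part_mon_partition)
  have inner: "part_mon W \<eta> = \<eta>" "part_mon (-W) \<eta> = {#}" if "\<eta> \<in> fiber W M \<nu>" for \<eta>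
    using that by (auto simp: fiber_def part_mon_id intro!: part_mon_disjoint)
  have outer: "part_mon W \<mu> + \<nu> = \<mu>" if "part_mon (-W) \<mu> = \<nu>" for \<mu>
    using that part_mon_partition by blast
  have "bij_betw (\<lambda>\<eta>. \<eta> + \<nu>) {\<eta> \<in> fiber W M \<nu>. size \<eta> = k}
      {\<mu> \<in> M. (part_mon (-W) \<mu>, size (part_mon W \<mu>)) = (\<nu>, k)}"
  proof (rule bij_betw_byWitness[where f' = "part_mon W"])
    show "(\<lambda>\<eta>. \<eta> + \<nu>) ` {\<eta> \<in> fiber W M \<nu>. size \<eta> = k}
        \<subseteq> {\<mu> \<in> M. (part_mon (-W) \<mu>, size (part_mon W \<mu>)) = (\<nu>, k)}"
      using inner nu assms by (auto simp: fiber_def)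
    show "part_mon W ` {\<mu> \<in> M. (part_mon (-W) \<mu>, size (part_mon W \<mu>)) = (\<nu>, k)}
        \<subseteq> {\<eta> \<in> fiber W M \<nu>. size \<eta> = k}"
      using outer by (auto simp: fiber_def)
  qed (use inner outer assms in auto)
  then show ?thesis
    unfolding F_vector_def by (rule bij_betw_same_card[symmetric])
qed

section \<open>The revlex order and its initial segments\<close>

text \<open>\<open>gt\<close> is a strict total order on \<open>U\<close> only; transitivity and
  totality of revlex are therefore proved for \<open>monomials\<close>, not for all
  multisets.\<close>

locale revlex_order =
  fixes U :: "'v set" and gt :: "'v \<Rightarrow> 'v \<Rightarrow> bool"
  assumes irrefl: "irreflp_on U gt" and trans: "transp_on U gt" and total: "totalp_on U gt"
begin

abbreviation rgt (infix "\<succ>\<^sub>r" 50) where "rgt \<equiv> revlex_gt gt"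

definition monomials :: "'v multiset set" where "monomials = {\<mu>. set_mset \<mu> \<subseteq> U}"

lemma gt_asym: "x \<in> U \<Longrightarrow> y \<in> U \<Longrightarrow> gt x y \<Longrightarrow> \<not> gt y x"
  using irrefl trans by (metis irreflp_onD transp_onD)

lemma gt_irrefl: "x \<in> U \<Longrightarrow> \<not> gt x x"
  using irrefl by (metis irreflp_onD)

lemma gt_trans: "x \<in> U \<Longrightarrow> y \<in> U \<Longrightarrow> z \<in> U \<Longrightarrow> gt x y \<Longrightarrow> gt y z \<Longrightarrow> gt x z"
  using trans by (metis transp_onD)

lemma gt_total: "x \<in> U \<Longrightarrow> y \<in> U \<Longrightarrow> x \<noteq> y \<Longrightarrow> gt x y \<or> gt y x"
  using total by (metis totalp_onD)

lemma ex_greatest: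
  assumes "finite S" "S \<noteq> {}" "S \<subseteq> U"
  shows "\<exists>x\<in>S. \<forall>y\<in>S. y \<noteq> x \<longrightarrow> gt x y"
  using assms
proof (induction S rule: finite_ne_induct)
  case (insert s S)
  then obtain x where x: "x \<in> S" "\<forall>y\<in>S. y \<noteq> x \<longrightarrow> gt x y" by auto
  show ?case
  proof (cases "gt x s")
    case True
    with x show ?thesis by auto
  next
    case False
    then have "gt s x" using insert x gt_total by blast
    then have "gt s y" if "y \<in> S" for y
      using x that insert.prems gt_trans[of s x y] by (cases "y = x") auto
    then show ?thesis by blast
  qed
qed auto

lemma ex_least:
  assumes "finite S" "S \<noteq> {}" "S \<subseteq> U"
  shows "\<exists>x\<in>S. \<forall>y\<in>S. y \<noteq> x \<longrightarrow> gt y x"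
  using assms
proof (induction S rule: finite_ne_induct)
  case (insert s S)
  then obtain x where x: "x \<in> S" "\<forall>y\<in>S. y \<noteq> x \<longrightarrow> gt y x" by auto
  show ?case
  proof (cases "gt s x")
    case True
    with x show ?thesis by auto
  next
    case False
    then have "gt x s" using insert x gt_total by blast
    then have "gt y s" if "y \<in> S" for y
      using x that insert.prems gt_trans[of y x s] by (cases "y = x") auto
    then show ?thesis by blast
  qed
qed auto

text \<open>Splitting off the greatest element repeatedly rebuilds a finite set from its least
  variable upwards, each new variable exceeding all earlier ones.\<close>

lemma greatest_induct [consumes 2, case_names empty insert]:
  assumes "finite S" "S \<subseteq> U" "P {}"
    and step: "\<And>x V. finite V \<Longrightarrow> insert x V \<subseteq> S \<Longrightarrow> x \<notin> V \<Longrightarrow> (\<And>v. v \<in> V \<Longrightarrow> gt x v) \<Longrightarrow> P V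
      \<Longrightarrow> P (insert x V)"
  shows "P S"
proof -
  have "V \<subseteq> S \<Longrightarrow> P V" for V
  proof (induction "card V" arbitrary: V)
    case 0
    then show ?case using assms finite_subset by fastforce
  next
    case (Suc n)
    then have fin: "finite V" and ne: "V \<noteq> {}"
      by (auto simp: card_ge_0_finite)
    then obtain x where x: "x \<in> V" "\<forall>y\<in>V. y \<noteq> x \<longrightarrow> gt x y"
      using ex_greatest[of V] Suc.prems assms(2) by blast
    have "P (V - {x})"
      using Suc x fin by (intro Suc.hyps) auto
    then have "P (insert x (V - {x}))"
      using x fin Suc.prems by (intro step) auto
    then show ?case using x by (simp add: insert_absorb)
  qed
  then show ?thesis by blast
qed

lemma rgt_irrefl: "\<not> \<mu> \<succ>\<^sub>r \<mu>"
  by (simp add: revlex_gt_def)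

lemma rgt_trans:
  assumes "\<mu> \<in> monomials" "\<nu> \<in> monomials" "\<rho> \<in> monomials" "\<mu> \<succ>\<^sub>r \<nu>" "\<nu> \<succ>\<^sub>r \<rho>"
  shows "\<mu> \<succ>\<^sub>r \<rho>"
proof -
  obtain x where x: "count \<mu> x < count \<nu> x" "\<And>z. z \<noteq> x \<Longrightarrow> count \<mu> z \<noteq> count \<nu> z \<Longrightarrow> gt z x"
    using assms unfolding revlex_gt_def by blast
  obtain y where y: "count \<nu> y < count \<rho> y" "\<And>z. z \<noteq> y \<Longrightarrow> count \<nu> z \<noteq> count \<rho> z \<Longrightarrow> gt z y"
    using assms unfolding revlex_gt_def by blast
  have xU: "x \<in> U" using x(1) assms(2) unfolding monomials_def
    by (metis count_greater_zero_iff gr_implies_not0 mem_Collect_eq not_gr_zero subsetD)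
  have yU: "y \<in> U" using y(1) assms(3) unfolding monomials_def
    by (metis count_greater_zero_iff gr_implies_not0 mem_Collect_eq not_gr_zero subsetD)
  have zU: "z \<in> U" if "count \<mu> z \<noteq> count \<nu> z \<or> count \<nu> z \<noteq> count \<rho> z" for z
    using that assms(1-3) unfolding monomials_def
    by (metis count_inI mem_Collect_eq subsetD)
  have sz: "size \<mu> = size \<rho>" using assms(4,5) by (simp add: revlex_gt_def)
  \<comment> \<open>The lesser of the two witnesses serves for the composite: the other comparison
    leaves the exponent there unchanged, since a change would place that variable above the other
    witness.\<close>
  consider "x = y" | "x \<noteq> y" "gt x y" | "x \<noteq> y" "gt y x" using gt_total xU yU by blast
  then show ?thesis
  proof cases
    case 1
    then show ?thesis unfolding revlex_gt_def using x y sz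
      by (metis order.strict_trans)
  next
    case 2
    have "count \<mu> y = count \<nu> y" using x(2)[of y] 2 gt_asym xU yU by metis
    moreover have "gt z y" if "z \<noteq> y" "count \<mu> z \<noteq> count \<rho> z" for z
      using that x(2)[of z] y(2)[of z] 2 gt_trans[of z x y] xU yU zU[of z] by metis
    ultimately show ?thesis unfolding revlex_gt_def using y(1) sz by metis
  next
    case 3
    have "count \<nu> x = count \<rho> x" using y(2)[of x] 3 gt_asym xU yU by metis
    moreover have "gt z x" if "z \<noteq> x" "count \<mu> z \<noteq> count \<rho> z" for z
      using that x(2)[of z] y(2)[of z] 3 gt_trans[of z y x] xU yU zU[of z] by metis
    ultimately show ?thesis unfolding revlex_gt_def using x(1) sz by metis
  qed
qed

lemma rgt_total:
  assumes "\<mu> \<in> monomials" "\<nu> \<in> monomials" "size \<mu> = size \<nu>" "\<mu> \<noteq> \<nu>"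
  shows "\<mu> \<succ>\<^sub>r \<nu> \<or> \<nu> \<succ>\<^sub>r \<mu>"
proof -
  let ?S = "{y. count \<mu> y \<noteq> count \<nu> y}"
  have sub: "?S \<subseteq> set_mset \<mu> \<union> set_mset \<nu>"
    by (auto simp: not_in_iff)
  moreover have "?S \<noteq> {}" using assms(4) by (auto simp: multiset_eq_iff)
  moreover have "finite ?S" using sub by (rule finite_subset) auto
  ultimately obtain x where "x \<in> ?S" "\<forall>y\<in>?S. y \<noteq> x \<longrightarrow> gt y x"
    using ex_least[of ?S] assms(1,2) unfolding monomials_def by blast
  then show ?thesis unfolding revlex_gt_def using assms(3) by (metis (mono_tags, lifting) linorder_neqE_nat mem_Collect_eq)
qed

text \<open>Since revlex relates only monomials of equal degree, this means an initial segment in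
  each degree separately; \<open>D\<close> may mix degrees.\<close>

definition initial :: "'v multiset set \<Rightarrow> 'v multiset set \<Rightarrow> bool" where
  "initial D N \<longleftrightarrow> (\<forall>\<mu>\<in>N. \<forall>\<mu>'\<in>D. \<mu>' \<succ>\<^sub>r \<mu> \<longrightarrow> \<mu>' \<in> N)"

lemma initialD: "initial D N \<Longrightarrow> \<mu> \<in> N \<Longrightarrow> \<mu>' \<in> D \<Longrightarrow> \<mu>' \<succ>\<^sub>r \<mu> \<Longrightarrow> \<mu>' \<in> N"
  unfolding initial_def by blast

text \<open>In a single degree \<open>D\<close> is a chain, so an element of \<open>A\<close>
  outside \<open>B\<close> would lie below all of \<open>B\<close> and force \<open>B\<close> to be
  a proper subset of \<open>A\<close>.\<close>

lemma initial_nested: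
  assumes "D \<subseteq> monomials" "A \<subseteq> D" "B \<subseteq> D" "initial D A" "initial D B" "finite A"
    and "card A \<le> card B" and "\<And>\<mu>. \<mu> \<in> D \<Longrightarrow> size \<mu> = k"
  shows "A \<subseteq> B"
proof (rule ccontr)
  assume "\<not> A \<subseteq> B"
  then obtain \<alpha> where \<alpha>: "\<alpha> \<in> A" "\<alpha> \<notin> B" by blast
  have "\<beta> \<in> A" if "\<beta> \<in> B" for \<beta>
  proof -
    have "\<beta> \<succ>\<^sub>r \<alpha> \<or> \<alpha> \<succ>\<^sub>r \<beta>"
      using \<alpha> that assms(1-3,8) by (metis rgt_total subsetD)
    then show ?thesis using \<alpha> that assms(2-5) by (meson initialD subsetD)
  qed
  then have "B \<subset> A" using \<alpha> by blast
  then have "card B < card A" by (rule psubset_card_mono[OF \<open>finite A\<close>])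
  then show False using assms(7) by simp
qed

text \<open>The position from the top serves twice: to pick the next monomial of an initial segment
  and, summed over a set, as the measure that makes compression terminate.\<close>

definition rank :: "'v multiset set \<Rightarrow> 'v multiset \<Rightarrow> nat" where
  "rank D \<mu> = card {\<nu> \<in> D. \<nu> \<succ>\<^sub>r \<mu>}"

lemma rank_less:
  assumes "finite D" "D \<subseteq> monomials" "\<mu> \<in> D" "\<nu> \<in> D" "\<mu> \<succ>\<^sub>r \<nu>"
  shows "rank D \<mu> < rank D \<nu>"
  unfolding rank_def
proof (rule psubset_card_mono)
  have "\<rho> \<succ>\<^sub>r \<nu>" if "\<rho> \<in> D" "\<rho> \<succ>\<^sub>r \<mu>" for \<rho>
    using that assms rgt_trans[of \<rho> \<mu> \<nu>] by blast
  then show "{\<rho> \<in> D. \<rho> \<succ>\<^sub>r \<mu>} \<subset> {\<rho> \<in> D. \<rho> \<succ>\<^sub>r \<nu>}"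
    using assms(3,5) rgt_irrefl by blast
qed (use assms in auto)

lemma ex_initial:
  assumes "finite D" "D \<subseteq> monomials" "n \<le> card D"
  shows "\<exists>K\<subseteq>D. initial D K \<and> card K = n"
  using assms(3)
proof (induction n)
  case 0
  then show ?case by (intro exI[of _ "{}"]) (auto simp: initial_def)
next
  case (Suc n)
  then obtain K where K: "K \<subseteq> D" "initial D K" "card K = n"
    using Suc_leD by blast
  have "D - K \<noteq> {}"
    using K Suc.prems by auto
  \<comment> \<open>Minimal rank outside \<open>K\<close> means that everything of \<open>D\<close>
    above \<open>\<mu>\<close> is already in \<open>K\<close>, even if \<open>D\<close> mixes
    degrees.\<close>
  then obtain \<mu> where \<mu>: "is_arg_min (rank D) (\<lambda>\<mu>. \<mu> \<in> D - K) \<mu>"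
    using ex_is_arg_min_if_finite[of "D - K" "rank D"] assms(1) by blast
  then have \<mu>D: "\<mu> \<in> D" "\<mu> \<notin> K" and \<mu>_min: "\<And>\<nu>. \<nu> \<in> D \<Longrightarrow> \<nu> \<notin> K \<Longrightarrow> \<not> rank D \<nu> < rank D \<mu>"
    by (auto simp: is_arg_min_def)
  have "initial D (insert \<mu> K)"
    unfolding initial_def
  proof (intro ballI impI)
    fix \<nu> \<nu>' assume \<nu>: "\<nu> \<in> insert \<mu> K" "\<nu>' \<in> D" "\<nu>' \<succ>\<^sub>r \<nu>"
    show "\<nu>' \<in> insert \<mu> K"
    proof (cases "\<nu> = \<mu>")
      case True
      then show ?thesis using \<mu>_min[of \<nu>'] rank_less[OF assms(1,2) \<nu>(2) \<mu>D(1)] \<nu> by blast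
    next
      case False
      then show ?thesis using \<nu> K(2) initialD by blast
    qed
  qed
  moreover have "card (insert \<mu> K) = Suc n"
    using K \<mu>D assms(1) finite_subset[of K D] by (simp add: card_insert_disjoint)
  ultimately show ?case using K(1) \<mu>D(1) by (intro exI[of _ "insert \<mu> K"]) simp
qed

end

section \<open>Compression\<close>

context revlex_order
begin

definition macaulay :: "'v multiset set \<Rightarrow> bool" where
  "macaulay D \<longleftrightarrow> (\<forall>M\<subseteq>D. multicomplex M \<longrightarrow>
     (\<exists>N\<subseteq>D. multicomplex N \<and> initial D N \<and> F_vector N = F_vector M))"

text \<open>Whole monomials are compared. As the outside parts agree and common factors cancel in
  revlex, this is the same as comparing the \<open>W\<close>-parts.\<close>

definition compressed_on :: "'v set \<Rightarrow> 'v multiset set \<Rightarrow> 'v multiset set \<Rightarrow> bool" where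
  "compressed_on W D N \<longleftrightarrow> (\<forall>\<mu>\<in>N. \<forall>\<mu>'\<in>D.
     part_mon (-W) \<mu>' = part_mon (-W) \<mu> \<longrightarrow> \<mu>' \<succ>\<^sub>r \<mu> \<longrightarrow> \<mu>' \<in> N)"

text \<open>For a multicomplex \<open>D\<close>, dividing an outside part by \<open>z\<close>
  enlarges the fiber. The second conjunct makes the smaller fiber an initial segment of the larger
  one.\<close>

definition compressible :: "'v set \<Rightarrow> 'v multiset set \<Rightarrow> bool" where
  "compressible W D \<longleftrightarrow>
     (\<forall>\<mu>\<in>D. macaulay (fiber W D (part_mon (-W) \<mu>))) \<and>
     (\<forall>\<mu>\<in>D. \<forall>z\<in>#\<mu>. z \<notin> W \<longrightarrow> (\<forall>\<kappa>\<in>D. part_mon (-W) \<kappa> = part_mon (-W) (\<mu> - {#z#}) \<longrightarrow>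
        \<kappa> \<succ>\<^sub>r \<mu> - {#z#} \<longrightarrow> add_mset z \<kappa> \<in> D))"

lemma compressed_onD:
  "compressed_on W D N \<Longrightarrow> \<mu> \<in> N \<Longrightarrow> \<mu>' \<in> D \<Longrightarrow> part_mon (-W) \<mu>' = part_mon (-W) \<mu> \<Longrightarrow>
    \<mu>' \<succ>\<^sub>r \<mu> \<Longrightarrow> \<mu>' \<in> N"
  unfolding compressed_on_def by blast

definition potential :: "'v multiset set \<Rightarrow> 'v multiset set \<Rightarrow> nat" where
  "potential D M = sum (rank D) M"

text \<open>All of \<open>E\<close> has one degree, so every element of \<open>C - A\<close>
  precedes every element of \<open>A - C\<close>. These differences have equal size, hence any
  bijection between them compares the two rank sums termwise.\<close>

lemma potential_initial_le:
  assumes "finite D" "D \<subseteq> monomials" "E \<subseteq> D" "A \<subseteq> E" "C \<subseteq> E" "card A = card C" "initial E C"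
    and size: "\<And>\<mu>. \<mu> \<in> E \<Longrightarrow> size \<mu> = k"
  shows "potential D C \<le> potential D A" and "A \<noteq> C \<Longrightarrow> potential D C < potential D A"
proof -
  have fin: "finite E" "finite A" "finite C"
    using assms(1,3-5) finite_subset by metis+
  have less: "rank D \<gamma> < rank D \<alpha>" if "\<gamma> \<in> C - A" "\<alpha> \<in> A - C" for \<gamma> \<alpha>
  proof -
    have E: "\<gamma> \<in> E" "\<alpha> \<in> E" "\<gamma> \<noteq> \<alpha>" using that assms(4,5) by auto
    have "\<not> \<alpha> \<succ>\<^sub>r \<gamma>" using that E initialD[OF assms(7)] by blast
    moreover have "\<gamma> \<in> monomials" "\<alpha> \<in> monomials" using E assms(2,3) by auto
    ultimately have "\<gamma> \<succ>\<^sub>r \<alpha>" using rgt_total[of \<gamma> \<alpha>] E size by metis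
    then show ?thesis using rank_less[OF assms(1,2)] E assms(3) by blast
  qed
  have "card (C - A) = card (A - C)"
    using assms(6) fin by (simp add: card_Diff_subset_Int Int_commute)
  then obtain h where h: "bij_betw h (C - A) (A - C)"
    using fin finite_same_card_bij[of "C - A" "A - C"] by blast
  have eq: "sum (rank D) (A - C) = (\<Sum>\<gamma>\<in>C - A. rank D (h \<gamma>))"
    using sum.reindex_bij_betw[OF h] by metis
  have split: "potential D C = sum (rank D) (C - A) + sum (rank D) (A \<inter> C)"
    "potential D A = sum (rank D) (A - C) + sum (rank D) (A \<inter> C)"
    using fin unfolding potential_def
    by (metis Int_commute add.commute sum.Int_Diff)+
  have less_h: "rank D \<gamma> < rank D (h \<gamma>)" if "\<gamma> \<in> C - A" for \<gamma>
    using that h less by (meson bij_betwE)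
  show "potential D C \<le> potential D A"
    unfolding split eq using less_h by (intro add_mono sum_mono) (auto intro: less_imp_le)
  assume "A \<noteq> C"
  then have "C - A \<noteq> {}"
    using assms(6) fin by (metis Diff_eq_empty_iff card_subset_eq)
  then have "sum (rank D) (C - A) < (\<Sum>\<gamma>\<in>C - A. rank D (h \<gamma>))"
    using fin less_h by (intro sum_strict_mono) auto
  then show "potential D C < potential D A"
    unfolding split eq by simp
qed

lemma compress:
  assumes D: "finite D" "D \<subseteq> monomials" "multicomplex D"
    and W: "compressible W D" and M: "M \<subseteq> D" "multicomplex M"
  obtains N where "N \<subseteq> D" "multicomplex N" "F_vector N = F_vector M" "compressed_on W D N"
    "N \<noteq> M \<Longrightarrow> potential D N < potential D M"
proof -
  let ?in = "part_mon W" and ?out = "part_mon (-W)"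
  have "\<exists>N\<subseteq>fiber W D \<nu>. multicomplex N \<and> initial (fiber W D \<nu>) N \<and> F_vector N = F_vector (fiber W M \<nu>)"
    if "\<nu> \<in> ?out ` D" for \<nu>
  proof -
    have "macaulay (fiber W D \<nu>)" using that W unfolding compressible_def by blast
    moreover have "fiber W M \<nu> \<subseteq> fiber W D \<nu>" using M(1) by (auto simp: fiber_def)
    moreover have "multicomplex (fiber W M \<nu>)" using M(2) by (rule multicomplex_fiber)
    ultimately show ?thesis unfolding macaulay_def by blast
  qed
  then obtain C where C: "\<And>\<nu>. \<nu> \<in> ?out ` D \<Longrightarrow> C \<nu> \<subseteq> fiber W D \<nu>"
    "\<And>\<nu>. \<nu> \<in> ?out ` D \<Longrightarrow> multicomplex (C \<nu>)"
    "\<And>\<nu>. \<nu> \<in> ?out ` D \<Longrightarrow> initial (fiber W D \<nu>) (C \<nu>)"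
    "\<And>\<nu>. \<nu> \<in> ?out ` D \<Longrightarrow> F_vector (C \<nu>) = F_vector (fiber W M \<nu>)"
    by metis
  define N where "N = {\<mu> \<in> D. ?in \<mu> \<in> C (?out \<mu>)}"
  have ND: "N \<subseteq> D" by (auto simp: N_def)
  have out_in: "?in \<nu> = {#}" if "\<nu> \<in> ?out ` D" for \<nu>
    using that by (auto intro!: part_mon_disjoint)
  have fiber_N: "fiber W N \<nu> = C \<nu>" if \<nu>: "\<nu> \<in> ?out ` D" for \<nu>
  proof -
    have "?out (\<eta> + \<nu>) = \<nu> \<and> ?in (\<eta> + \<nu>) = \<eta>" if "set_mset \<eta> \<subseteq> W" for \<eta>
    proof -
      have "?out \<eta> = {#}" using that by (intro part_mon_disjoint) auto
      moreover have "?out \<nu> = \<nu>" using \<nu> by (auto intro!: part_mon_id)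
      ultimately show ?thesis using out_in[OF \<nu>] part_mon_id[OF that] by simp
    qed
    then show ?thesis using C(1)[OF \<nu>] by (auto simp: fiber_def N_def)
  qed

  have "multicomplex N"
  proof (rule multicomplexI_remove1)
    fix \<mu> z assume \<mu>: "\<mu> \<in> N" and z: "z \<in># \<mu>"
    define \<nu> \<eta> where "\<nu> = ?out \<mu>" and "\<eta> = ?in \<mu>"
    have \<mu>D: "\<mu> \<in> D" and \<eta>C: "\<eta> \<in> C \<nu>" and \<nu>: "\<nu> \<in> ?out ` D"
      using \<mu> by (auto simp: N_def \<nu>_def \<eta>_def)
    have \<mu>z: "\<mu> - {#z#} \<in> D"
      using multicomplexD[OF D(3) \<mu>D] by simp
    show "\<mu> - {#z#} \<in> N"
    \<comment> \<open>Dividing by a variable of \<open>W\<close> stays in the same fiber, where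
      \<open>C \<nu>\<close> is a multicomplex. Otherwise the \<open>W\<close>-part is unchanged but
      now belongs to the fiber over \<open>\<nu>'\<close>, so \<open>C \<nu>\<close> must be
      contained in \<open>C \<nu>'\<close> in the degree of that part.\<close>
    proof (cases "z \<in> W")
      case True
      have "?out (\<mu> - {#z#}) = \<nu>" "?in (\<mu> - {#z#}) \<subseteq># \<eta>"
        using True by (auto simp: \<nu>_def \<eta>_def)
      then show ?thesis
        using \<mu>z multicomplexD[OF C(2)[OF \<nu>] \<eta>C] by (simp add: N_def)
    next
      case False
      define \<nu>' where "\<nu>' = ?out (\<mu> - {#z#})"
      have \<nu>': "\<nu>' \<in> ?out ` D" using \<mu>z unfolding \<nu>'_def by (rule imageI)
      have zv: "z \<in># \<nu>" using z False by (simp add: \<nu>_def)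
      have \<nu>'_eq: "\<nu>' = \<nu> - {#z#}" and in_z: "?in (\<mu> - {#z#}) = \<eta>"
        using False by (auto simp: \<nu>_def \<nu>'_def \<eta>_def)
      have \<nu>z: "\<nu> = add_mset z \<nu>'" using zv \<nu>'_eq by simp
      have fib_sub: "fiber W K \<nu> \<subseteq> fiber W K \<nu>'" if "multicomplex K" for K
        using multicomplexD[OF that] by (force simp: fiber_def \<nu>z)
      define L where "L = {\<eta> \<in> fiber W D \<nu>'. size \<eta> = size (?in \<mu>)}"
      define A where "A = {\<alpha> \<in> C \<nu>. size \<alpha> = size (?in \<mu>)}"
      define B where "B = {\<alpha> \<in> C \<nu>'. size \<alpha> = size (?in \<mu>)}"
      have "A \<subseteq> B"
      proof (rule initial_nested[where D = L])
        show "L \<subseteq> monomials"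
          using D(2) by (fastforce simp: L_def fiber_def monomials_def)
        show AL: "A \<subseteq> L" using C(1)[OF \<nu>] fib_sub[OF D(3)] by (auto simp: A_def L_def)
        show "B \<subseteq> L" using C(1)[OF \<nu>'] by (auto simp: B_def L_def)
        show "initial L B"
          using C(3)[OF \<nu>'] by (auto simp: initial_def L_def B_def)
        \<comment> \<open>The nesting conjunct of \<open>compressible\<close> puts
          \<open>\<kappa>\<close> into the smaller fiber, where \<open>C \<nu>\<close> is known to
          be initial.\<close>
        show "initial L A" unfolding initial_def
        proof (intro ballI impI)
          fix \<alpha> \<kappa> assume \<alpha>: "\<alpha> \<in> A" and \<kappa>: "\<kappa> \<in> L" "\<kappa> \<succ>\<^sub>r \<alpha>"
          have \<alpha>D: "\<alpha> + \<nu> \<in> D" "\<alpha> \<in> C \<nu>" and \<kappa>D: "\<kappa> + \<nu>' \<in> D" "set_mset \<kappa> \<subseteq> W"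
            using \<alpha> \<kappa> C(1)[OF \<nu>] by (auto simp: A_def L_def fiber_def)
          have "set_mset \<alpha> \<subseteq> W" using \<alpha>D C(1)[OF \<nu>] by (auto simp: fiber_def)
          then have out_eq: "?out \<kappa> = {#}" "?out \<alpha> = {#}"
            using \<kappa>D(2) by (auto intro!: part_mon_disjoint)
          have "(\<alpha> + \<nu>) - {#z#} = \<alpha> + \<nu>'" by (simp add: \<nu>z)
          moreover have "z \<in># \<alpha> + \<nu>" by (simp add: \<nu>z)
          moreover have "?out (\<kappa> + \<nu>') = ?out (\<alpha> + \<nu>')" using out_eq by simp
          moreover have "\<kappa> + \<nu>' \<succ>\<^sub>r \<alpha> + \<nu>'" using \<kappa>(2) by simp
          ultimately have "add_mset z (\<kappa> + \<nu>') \<in> D"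
            using W False \<alpha>D(1) \<kappa>D(1) unfolding compressible_def by metis
          then have "\<kappa> \<in> fiber W D \<nu>" using \<kappa>D(2) by (simp add: fiber_def \<nu>z)
          then have "\<kappa> \<in> C \<nu>" using initialD[OF C(3)[OF \<nu>] \<alpha>D(2)] \<kappa>(2) by blast
          then show "\<kappa> \<in> A" using \<kappa> by (simp add: A_def L_def)
        qed
        show "finite A"
          using AL finite_fiber[OF D(1), of W \<nu>'] finite_subset by (fastforce simp: L_def)
        \<comment> \<open>The sizes of \<open>A\<close> and \<open>B\<close> are inherited from the
          fibers of \<open>M\<close>, which are nested because \<open>M\<close> is a
          multicomplex.\<close>
        have "F_vector (fiber W M \<nu>) k \<le> F_vector (fiber W M \<nu>') k" for k
          using fib_sub[OF M(2)] finite_fiber finite_subset[OF M(1) D(1)] by (intro F_vector_mono) auto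
        then show "card A \<le> card B"
          unfolding A_def B_def F_vector_def[symmetric] C(4)[OF \<nu>] C(4)[OF \<nu>'] .
        show "\<And>\<mu>'. \<mu>' \<in> L \<Longrightarrow> size \<mu>' = size (?in \<mu>)" by (simp add: L_def)
      qed
      then have "\<eta> \<in> C \<nu>'" using \<eta>C by (auto simp: A_def B_def \<eta>_def)
      then show ?thesis using \<mu>z in_z by (simp add: N_def \<nu>'_def)
    qed
  qed

  \<comment> \<open>The classes of \<open>key\<close> fix the outside part and the degree inside
    \<open>W\<close>, hence the total degree. Both the \<open>F\<close>-vector and the potential
    split as sums over these classes.\<close>
  define key where "key = (\<lambda>\<mu>. (?out \<mu>, size (?in \<mu>)))"
  define T where "T = key ` D"
  define cls where "cls = (\<lambda>K y. {\<mu> \<in> K. key \<mu> = y})"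
  have finT: "finite T" using D(1) by (simp add: T_def)
  have card_cls: "card (cls N y) = card (cls M y)" if "y \<in> T" for y
  proof -
    have \<nu>: "fst y \<in> ?out ` D" using that by (auto simp: T_def key_def)
    show ?thesis
      using card_fiber_slice[OF out_in[OF \<nu>], of _ "snd y"] fiber_N[OF \<nu>] C(4)[OF \<nu>]
      by (simp add: cls_def key_def)
  qed

  have F_eq: "F_vector N = F_vector M"
  proof
    fix j
    have "F_vector K j = (\<Sum>y\<in>T. if size (fst y) + snd y = j then card (cls K y) else 0)"
      if K: "K \<subseteq> D" for K
    proof -
      let ?S = "{\<mu> \<in> K. size \<mu> = j}"
      have "finite ?S" using K D(1) finite_subset by fastforce
      then have "(\<Sum>y\<in>T. sum (\<lambda>_. 1) {\<mu> \<in> ?S. key \<mu> = y}) = sum (\<lambda>_. 1::nat) ?S"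
        using K by (intro sum.group finT) (auto simp: T_def)
      then have "F_vector K j = (\<Sum>y\<in>T. card {\<mu> \<in> ?S. key \<mu> = y})"
        by (simp only: F_vector_def card_eq_sum)
      also have "\<dots> = (\<Sum>y\<in>T. if size (fst y) + snd y = j then card (cls K y) else 0)"
      proof (rule sum.cong)
        fix y
        have "size \<mu> = size (fst y) + snd y" if "key \<mu> = y" for \<mu>
          using size_part_mon_partition[of W \<mu>] that by (auto simp: key_def)
        then have "{\<mu> \<in> ?S. key \<mu> = y} = (if size (fst y) + snd y = j then cls K y else {})"
          by (auto simp: cls_def)
        then show "card {\<mu> \<in> ?S. key \<mu> = y} = (if size (fst y) + snd y = j then card (cls K y) else 0)"
          by simp
      qed simp
      finally show ?thesis .
    qed
    then show "F_vector N j = F_vector M j"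
      using ND M(1) card_cls by (auto intro!: sum.cong)
  qed

  have comp: "compressed_on W D N"
    unfolding compressed_on_def
  proof (intro ballI impI)
    fix \<mu> \<mu>' assume *: "\<mu> \<in> N" "\<mu>' \<in> D" "?out \<mu>' = ?out \<mu>" "\<mu>' \<succ>\<^sub>r \<mu>"
    have \<nu>: "?out \<mu> \<in> ?out ` D" using *(1) ND by blast
    have "?in \<mu>' \<succ>\<^sub>r ?in \<mu>"
      using *(3,4) revlex_gt_add_right[of gt "?in \<mu>'" "?out \<mu>" "?in \<mu>"] part_mon_partition by metis
    moreover have "?in \<mu>' \<in> fiber W D (?out \<mu>)"
      using * part_mon_partition[of W \<mu>'] by (simp add: fiber_def)
    ultimately have "?in \<mu>' \<in> C (?out \<mu>)"
      using initialD[OF C(3)[OF \<nu>]] *(1) by (auto simp: N_def)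
    then show "\<mu>' \<in> N" using * by (simp add: N_def)
  qed

  \<comment> \<open>Within a class, \<open>N\<close> is an initial segment with as many elements as
    \<open>M\<close> has there.\<close>
  have cls_pot: "potential D (cls N y) \<le> potential D (cls M y)"
    "cls M y \<noteq> cls N y \<Longrightarrow> potential D (cls N y) < potential D (cls M y)" if "y \<in> T" for y
  proof -
    have 1: "cls D y \<subseteq> D" "cls M y \<subseteq> cls D y" "cls N y \<subseteq> cls D y"
      using M(1) ND by (auto simp: cls_def)
    have 2: "size \<mu> = size (fst y) + snd y" if "\<mu> \<in> cls D y" for \<mu>
      using size_part_mon_partition[of W \<mu>] that by (auto simp: cls_def key_def)
    have 3: "initial (cls D y) (cls N y)"
      using comp by (force simp: initial_def cls_def key_def compressed_on_def)
    show "potential D (cls N y) \<le> potential D (cls M y)"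
      "cls M y \<noteq> cls N y \<Longrightarrow> potential D (cls N y) < potential D (cls M y)"
      using potential_initial_le[OF D(1,2) 1 card_cls[OF that, symmetric] 3 2] by auto
  qed
  have pot: "potential D K = (\<Sum>y\<in>T. potential D (cls K y))" if "K \<subseteq> D" for K
    unfolding potential_def cls_def
    using that by (intro sum.group[symmetric] finT finite_subset[OF that D(1)]) (auto simp: T_def)
  have "potential D N < potential D M" if "N \<noteq> M"
  proof -
    obtain \<mu> where "\<mu> \<in> N \<union> M" "\<not> (\<mu> \<in> N \<and> \<mu> \<in> M)" using \<open>N \<noteq> M\<close> by blast
    then have "cls M (key \<mu>) \<noteq> cls N (key \<mu>)" "key \<mu> \<in> T"
      using ND M(1) by (auto simp: cls_def T_def)
    then show ?thesis
      unfolding pot[OF ND] pot[OF M(1)] using cls_pot(2)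
      by (intro sum_strict_mono_ex1[OF finT]) (use cls_pot(1) in blast)+
  qed
  with that ND \<open>multicomplex N\<close> F_eq comp show ?thesis by blast
qed

text \<open>If \<open>M\<close> is not compressed on some \<open>W\<close> of the family, then
  compressing on \<open>W\<close> changes \<open>M\<close>, so the potential drops strictly. Later
  compressions may destroy earlier ones, but the descent must end.\<close>

lemma compress_family:
  assumes D: "finite D" "D \<subseteq> monomials" "multicomplex D"
    and W: "\<And>W. W \<in> \<W> \<Longrightarrow> compressible W D" and M: "M \<subseteq> D" "multicomplex M"
  shows "\<exists>N\<subseteq>D. multicomplex N \<and> F_vector N = F_vector M \<and> (\<forall>W\<in>\<W>. compressed_on W D N)"
  using M
proof (induction "potential D M" arbitrary: M rule: less_induct)
  case less
  show ?case
  proof (cases "\<forall>W\<in>\<W>. compressed_on W D M")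
    case True
    with less.prems show ?thesis by blast
  next
    case False
    then obtain W where "W \<in> \<W>" and not: "\<not> compressed_on W D M" by blast
    then obtain N where N: "N \<subseteq> D" "multicomplex N" "F_vector N = F_vector M" "compressed_on W D N"
      "N \<noteq> M \<Longrightarrow> potential D N < potential D M"
      using compress[OF D _ less.prems] assms(4) by metis
    then have "potential D N < potential D M" using not by blast
    then show ?thesis using less.hyps[OF _ N(1,2)] N(3) by metis
  qed
qed

end

section \<open>Two variables\<close>

text \<open>\<open>A\<close> and \<open>B\<close> model the exponents of \<open>y\<close> in degrees
  \<open>k\<close> and \<open>k - 1\<close> of a multicomplex in \<open>x\<close>, \<open>y\<close>:
  keeping \<open>f\<close> is division by \<open>x\<close>, lowering it is division by
  \<open>y\<close>. At a gap \<open>g\<close> of \<open>A\<close>, keeping exponents below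
  \<open>g\<close> and lowering those above is injective. Without a gap, \<open>B\<close> contains
  all \<open>k\<close> exponents.\<close>

lemma card_shadow_nat:
  fixes A B :: "nat set"
  assumes "finite B" "A \<subseteq> {..k}" and shadow: "\<And>f. f \<in> A \<Longrightarrow> f < k \<Longrightarrow> f \<in> B" "\<And>f. f \<in> A \<Longrightarrow> 0 < f \<Longrightarrow> f - 1 \<in> B"
  shows "min (card A) k \<le> card B"
proof (cases "{..k} \<subseteq> A")
  case True
  then have "{..<k} \<subseteq> B" using shadow(1) by (simp add: subset_iff)
  then have "k \<le> card B" using card_mono[OF assms(1), of "{..<k}"] by simp
  then show ?thesis by simp
next
  case False
  then obtain g where g: "g \<le> k" "g \<notin> A" by auto
  let ?h = "\<lambda>f. if f < g then f else f - 1"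
  have above: "f > g" if "f \<in> A" "\<not> f < g" for f
    using that g by (metis linorder_neqE_nat)
  have "inj_on ?h A"
  proof (rule inj_onI)
    fix e f assume "e \<in> A" "f \<in> A" "?h e = ?h f"
    then show "e = f"
      using above[of e] above[of f] by (cases "e < g"; cases "f < g") simp_all
  qed
  moreover have "?h f \<in> B" if "f \<in> A" for f
    using shadow[OF that] above[OF that] g(1) by (cases "f < g") auto
  then have "?h ` A \<subseteq> B" by blast
  ultimately have "card A \<le> card B" using assms(1) by (rule card_inj_on_le)
  then show ?thesis by simp
qed

lemma two_variable_monomial:
  assumes "set_mset \<mu> \<subseteq> {x, y}" "x \<noteq> y"
  shows "\<mu> = replicate_mset (count \<mu> x) x + replicate_mset (count \<mu> y) y"
    and "size \<mu> = count \<mu> x + count \<mu> y"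
proof -
  show eq: "\<mu> = replicate_mset (count \<mu> x) x + replicate_mset (count \<mu> y) y"
    using assms by (intro multiset_eqI) (auto simp: not_in_iff[symmetric])
  show "size \<mu> = count \<mu> x + count \<mu> y"
    using arg_cong[OF eq, of size] by simp
qed

text \<open>In fixed degree the exponent of \<open>y\<close> determines the monomial. The bound
  \<open>f \<le> k\<close> matters because \<open>k - f\<close> is truncated subtraction.\<close>

lemma F_vector_two_variables:
  assumes "x \<noteq> y" "\<And>\<mu>. \<mu> \<in> K \<Longrightarrow> set_mset \<mu> \<subseteq> {x, y}"
  shows "F_vector K k = card {f. f \<le> k \<and> replicate_mset (k - f) x + replicate_mset f y \<in> K}"
proof -
  let ?mk = "\<lambda>f. replicate_mset (k - f) x + replicate_mset f y"
  let ?F = "{f. f \<le> k \<and> ?mk f \<in> K}" and ?K = "{\<mu> \<in> K. size \<mu> = k}"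
  have recover: "?mk (count \<mu> y) = \<mu>" "count \<mu> y \<le> k" if "\<mu> \<in> K" "size \<mu> = k" for \<mu>
    using two_variable_monomial[OF assms(2)[OF that(1)] assms(1)] that(2) by simp_all
  have "bij_betw ?mk ?F ?K"
  proof (rule bij_betw_byWitness[where f' = "\<lambda>\<mu>. count \<mu> y"])
    show "(\<lambda>\<mu>. count \<mu> y) ` ?K \<subseteq> ?F" using recover by auto
  qed (use assms(1) recover in auto)
  then show ?thesis unfolding F_vector_def by (rule bij_betw_same_card[symmetric])
qed

context revlex_order
begin

text \<open>The replacement \<open>N\<close> has the same \<open>F\<close>-vector as
  \<open>M\<close>, hence no monomials in degrees that the bound excludes. In applications
  \<open>e\<close> is the degree of a fixed outside part.\<close>

lemma macaulay_truncate:
  assumes "finite D" "macaulay D"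
  shows "macaulay {\<mu> \<in> D. size \<mu> + e \<le> d}"
  unfolding macaulay_def
proof (intro allI impI)
  fix M assume M: "M \<subseteq> {\<mu> \<in> D. size \<mu> + e \<le> d}" "multicomplex M"
  then obtain N where N: "N \<subseteq> D" "multicomplex N" "initial D N" "F_vector N = F_vector M"
    using assms(2) unfolding macaulay_def by blast
  have "size \<mu> + e \<le> d" if "\<mu> \<in> N" for \<mu>
  proof -
    \<comment> \<open>Finiteness is essential here: \<open>card\<close> of an infinite set would be
      0.\<close>
    have "finite {\<nu> \<in> N. size \<nu> = size \<mu>}" using N(1) assms(1) finite_subset by fastforce
    then have "F_vector N (size \<mu>) \<noteq> 0" using that by (auto simp: F_vector_def)
    then have "card {\<nu> \<in> M. size \<nu> = size \<mu>} \<noteq> 0" using N(4) by (metis F_vector_def)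
    then have "{\<nu> \<in> M. size \<nu> = size \<mu>} \<noteq> {}" by (metis card.empty)
    then show ?thesis using M(1) by auto
  qed
  with N show "\<exists>N\<subseteq>{\<mu> \<in> D. size \<mu> + e \<le> d}. multicomplex N \<and>
      initial {\<mu> \<in> D. size \<mu> + e \<le> d} N \<and> F_vector N = F_vector M"
    by (intro exI[of _ N]) (auto simp: initial_def)
qed

text \<open>With \<open>gt x y\<close>, revlex in a fixed degree lists monomials by increasing
  exponent of \<open>y\<close>. So the initial segment of size \<open>n\<close> consists of the
  exponents below \<open>n\<close>, and only these sizes have to be compared between consecutive
  degrees.\<close>

lemma macaulay_two_variables:
  assumes xy: "x \<in> U" "y \<in> U" "gt x y" and D: "finite D" "\<And>\<mu>. \<mu> \<in> D \<Longrightarrow> set_mset \<mu> \<subseteq> {x, y}"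
    and closed: "\<And>\<mu> \<kappa>. \<mu> \<in> D \<Longrightarrow> set_mset \<kappa> \<subseteq> {x, y} \<Longrightarrow> size \<kappa> = size \<mu> \<Longrightarrow>
      count \<kappa> y \<le> count \<mu> y \<Longrightarrow> \<kappa> \<in> D"
  shows "macaulay D"
  unfolding macaulay_def
proof (intro allI impI)
  fix M assume M: "M \<subseteq> D" "multicomplex M"
  have neq: "x \<noteq> y" using xy gt_irrefl by blast
  let ?mk = "\<lambda>k f. replicate_mset (k - f) x + replicate_mset f y"
  define G where "G = (\<lambda>K k. {f. f \<le> k \<and> ?mk k f \<in> K})"
  define N where "N = {\<mu>. set_mset \<mu> \<subseteq> {x, y} \<and> count \<mu> y < F_vector M (size \<mu>)}"
  have F: "F_vector K k = card (G K k)" if "\<And>\<mu>. \<mu> \<in> K \<Longrightarrow> set_mset \<mu> \<subseteq> {x, y}" for K k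
    unfolding G_def by (rule F_vector_two_variables[OF neq that])
  have finG: "finite (G K k)" for K k by (rule finite_subset[of _ "{..k}"]) (auto simp: G_def)
  have FM: "F_vector M k = card (G M k)" for k using F M(1) D(2) by blast
  have mk: "?mk (size \<mu>) (count \<mu> y) = \<mu>" "size \<mu> = count \<mu> x + count \<mu> y"
    if "set_mset \<mu> \<subseteq> {x, y}" for \<mu>
    using two_variable_monomial[OF that neq] by simp_all
  have shadow: "min (F_vector M (Suc k)) (Suc k) \<le> F_vector M k" for k
    unfolding FM
  proof (rule card_shadow_nat[OF finG])
    show "G M (Suc k) \<subseteq> {..Suc k}" by (auto simp: G_def)
    fix f assume f: "f \<in> G M (Suc k)"
    show "f \<in> G M k" if "f < Suc k"
    proof -
      have "?mk k f \<subseteq># ?mk (Suc k) f" using that by (simp add: Suc_diff_le)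
      then show ?thesis using f that multicomplexD[OF M(2)] by (auto simp: G_def)
    qed
    show "f - 1 \<in> G M k" if "0 < f"
    proof -
      have "?mk k (f - 1) \<subseteq># ?mk (Suc k) f" using that by (cases f) auto
      then show ?thesis using f that multicomplexD[OF M(2)] by (auto simp: G_def)
    qed
  qed
  have ND: "N \<subseteq> D"
  proof
    fix \<mu> assume \<mu>: "\<mu> \<in> N"
    then have sub: "set_mset \<mu> \<subseteq> {x, y}" and lt: "count \<mu> y < F_vector M (size \<mu>)" by (auto simp: N_def)
    \<comment> \<open>More than \<open>count \<mu> y\<close> distinct exponents occur in
      \<open>M\<close>, so they cannot all lie below \<open>count \<mu> y\<close>;
      \<open>closed\<close> then descends from such an \<open>f\<close>.\<close>
    obtain f where f: "f \<in> G M (size \<mu>)" "count \<mu> y \<le> f"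
    proof (rule ccontr)
      assume "\<not> thesis"
      then have "G M (size \<mu>) \<subseteq> {..<count \<mu> y}" using that by force
      then show False using lt unfolding FM
        by (metis card_lessThan card_mono finite_lessThan leD)
    qed
    show "\<mu> \<in> D"
    proof (rule closed[OF _ sub])
      show "?mk (size \<mu>) f \<in> D" using f(1) M(1) by (auto simp: G_def)
      show "size \<mu> = size (?mk (size \<mu>) f)" using f(1) by (simp add: G_def)
      show "count \<mu> y \<le> count (?mk (size \<mu>) f) y" using f(2) neq by simp
    qed
  qed
  moreover have "multicomplex N"
  proof (rule multicomplexI_remove1)
    fix \<mu> z assume \<mu>: "\<mu> \<in> N" and z: "z \<in># \<mu>"
    have sub: "set_mset \<mu> \<subseteq> {x, y}" and lt: "count \<mu> y < F_vector M (size \<mu>)"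
      using \<mu> by (auto simp: N_def)
    obtain k where k: "size \<mu> = Suc k" "size (\<mu> - {#z#}) = k"
      using z by (metis size_Suc_Diff1 nat.inject)
    have sub': "set_mset (\<mu> - {#z#}) \<subseteq> {x, y}" using sub by (meson in_diffD subset_iff)
    \<comment> \<open>The bound by \<open>Suc k\<close> holds since the quotient has degree
      \<open>k\<close>. It covers the case where degree \<open>Suc k\<close> is full, in which the
      shadow is one smaller.\<close>
    have "count (\<mu> - {#z#}) y < min (F_vector M (Suc k)) (Suc k)"
    proof (cases "z = y")
      case True
      then obtain c where "count \<mu> y = Suc c" using z by (metis count_greater_zero_iff gr0_conv_Suc)
      then show ?thesis using True lt k(1) mk(2)[OF sub] by auto
    next
      case False
      then have "z = x" using z sub by auto
      then obtain c where "count \<mu> x = Suc c" using z by (metis count_greater_zero_iff gr0_conv_Suc)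
      then show ?thesis using False lt k(1) mk(2)[OF sub] by simp
    qed
    then have "count (\<mu> - {#z#}) y < F_vector M k"
      using shadow[of k] by (rule less_le_trans)
    then show "\<mu> - {#z#} \<in> N"
      using sub' by (simp only: N_def mem_Collect_eq k(2) simp_thms)
  qed
  moreover have "initial D N"
    unfolding initial_def
  proof (intro ballI impI)
    fix \<mu> \<kappa> assume \<mu>: "\<mu> \<in> N" and \<kappa>: "\<kappa> \<in> D" "\<kappa> \<succ>\<^sub>r \<mu>"
    obtain u where u: "count \<kappa> u < count \<mu> u" "\<And>v. v \<noteq> u \<Longrightarrow> count \<kappa> v \<noteq> count \<mu> v \<Longrightarrow> gt v u"
      using \<kappa>(2) unfolding revlex_gt_def by blast
    have "u \<in># \<mu>" using u(1) by (metis count_inI not_less_zero)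
    then have "u \<in> {x, y}" using \<mu> by (auto simp: N_def)
    then have "count \<kappa> y \<le> count \<mu> y" using u gt_asym[OF xy] neq by (metis insertE less_imp_le order_refl singletonD)
    then show "\<kappa> \<in> N" using \<mu> \<kappa> D(2) revlex_gt_size[OF \<kappa>(2)] by (auto simp: N_def)
  qed
  moreover have "F_vector N = F_vector M"
  proof
    fix k
    \<comment> \<open>There are only \<open>k + 1\<close> exponents in degree \<open>k\<close>, so
      all exponents below \<open>F_vector M k\<close> are realised in \<open>N\<close>.\<close>
    have "card (G M k) \<le> card {..k}" by (rule card_mono) (auto simp: G_def)
    then have le: "F_vector M k \<le> Suc k" using FM by simp
    have "f \<in> G N k \<longleftrightarrow> f < F_vector M k" for f
      using le neq by (cases "f \<le> k") (auto simp: G_def N_def)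
    then have "G N k = {..<F_vector M k}" by blast
    then show "F_vector N k = F_vector M k" using F[of N k] by (simp add: N_def)
  qed
  ultimately show "\<exists>N\<subseteq>D. multicomplex N \<and> initial D N \<and> F_vector N = F_vector M" by blast
qed

end

section \<open>Adding a greatest variable\<close>

lemma finite_monomials:
  assumes "finite V"
  shows "finite {\<mu>. set_mset \<mu> \<subseteq> V \<and> size \<mu> \<le> d}"
proof -
  have "{\<mu>. set_mset \<mu> \<subseteq> V \<and> size \<mu> \<le> d} = (\<Union>n\<le>d. multisets_of_size V n)"
    by (auto simp: multisets_of_size_def)
  then show ?thesis using assms by auto
qed

lemma part_mon_singleton: "part_mon {x} \<mu> = replicate_mset (count \<mu> x) x"
  by (rule multiset_eqI) auto

text \<open>The new variable \<open>x\<close> is restricted only by the total degree, which keeps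
  the set finite.\<close>

definition extend :: "'v \<Rightarrow> nat \<Rightarrow> 'v multiset set \<Rightarrow> 'v multiset set" where
  "extend x d D = {\<mu>. part_mon (- {x}) \<mu> \<in> D \<and> size \<mu> \<le> d}"

lemma multicomplex_extend:
  assumes "multicomplex D"
  shows "multicomplex (extend x d D)"
  unfolding multicomplex_def extend_def
  using multicomplexD[OF assms] part_mon_mono size_mset_mono by (blast intro: order_trans)

lemma finite_extend:
  assumes "finite D"
  shows "finite (extend x d D)"
proof (rule finite_subset)
  show "extend x d D \<subseteq> {\<mu>. set_mset \<mu> \<subseteq> insert x (\<Union>(set_mset ` D)) \<and> size \<mu> \<le> d}"
    by (force simp: extend_def)
qed (use assms in \<open>auto intro: finite_monomials\<close>)

context revlex_order
begin

lemma swap_rgt: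
  assumes "x \<in> U" "y \<in> U" "gt x y" "y \<in># \<mu>"
  shows "add_mset x (\<mu> - {#y#}) \<succ>\<^sub>r \<mu>"
proof -
  have "x \<noteq> y" using assms gt_irrefl by blast
  moreover have "size (add_mset x (\<mu> - {#y#})) = size \<mu>"
    using assms(4) by (simp add: size_Suc_Diff1)
  ultimately show ?thesis
    unfolding revlex_gt_def using assms(3,4) by (auto intro!: exI[of _ y] split: if_splits)
qed

text \<open>Replacing the greatest variable of \<open>\<mu>\<close> other than \<open>x\<close> by \<open>x\<close> cannot overshoot \<open>\<kappa>\<close>
  as long as \<open>\<kappa>\<close> contains more factors \<open>x\<close> than \<open>\<mu>\<close>.\<close>

lemma reach_by_swaps:
  assumes x: "x \<in> U" "V \<subseteq> U" "x \<notin> V" "\<And>v. v \<in> V \<Longrightarrow> gt x v"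
    and A: "\<And>\<alpha>. \<alpha> \<in> A \<Longrightarrow> set_mset \<alpha> \<subseteq> insert x V"
    and swap: "\<And>\<alpha> y. \<alpha> \<in> A \<Longrightarrow> y \<in># \<alpha> \<Longrightarrow> y \<in> V \<Longrightarrow> add_mset x (\<alpha> - {#y#}) \<in> A"
    and \<kappa>: "set_mset \<kappa> \<subseteq> insert x V"
    and "\<mu> \<in> A" "\<kappa> \<succ>\<^sub>r \<mu>" "count \<mu> x \<le> count \<kappa> x"
  shows "\<exists>\<alpha>\<in>A. count \<alpha> x = count \<kappa> x \<and> (\<kappa> = \<alpha> \<or> \<kappa> \<succ>\<^sub>r \<alpha>)"
  using assms(8-10)
proof (induction "count \<kappa> x - count \<mu> x" arbitrary: \<mu>)
  case 0
  then show ?case by (intro bexI[of _ \<mu>]) auto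
next
  case (Suc n)
  then have lt: "count \<mu> x < count \<kappa> x" by simp
  obtain v where v: "count \<kappa> v < count \<mu> v" "\<And>u. u \<noteq> v \<Longrightarrow> count \<kappa> u \<noteq> count \<mu> u \<Longrightarrow> gt u v"
    and size: "size \<kappa> = size \<mu>"
    using Suc.prems(2) unfolding revlex_gt_def by blast
  have "v \<noteq> x" using v(1) lt by auto
  moreover have "v \<in># \<mu>" using v(1) by (metis count_inI not_less_zero)
  ultimately have vV: "v \<in> set_mset \<mu> \<inter> V" using A[OF Suc.prems(1)] by auto
  then obtain w where w: "w \<in> set_mset \<mu> \<inter> V" "\<And>u. u \<in> set_mset \<mu> \<inter> V \<Longrightarrow> u \<noteq> w \<Longrightarrow> gt w u"
    using ex_greatest[of "set_mset \<mu> \<inter> V"] x(2) by blast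
  define \<mu>' where "\<mu>' = add_mset x (\<mu> - {#w#})"
  have wx: "w \<noteq> x" using w x by blast
  have \<mu>': "count \<mu>' u = (if u = x then Suc (count \<mu> x) else if u = w then count \<mu> w - 1 else count \<mu> u)" for u
    using wx by (simp add: \<mu>'_def)
  have "size \<mu>' = size \<mu>" using w(1) by (simp add: \<mu>'_def size_Suc_Diff1)
  then have size': "size \<kappa> = size \<mu>'" using size by simp
  have A': "\<mu>' \<in> A" using swap[OF Suc.prems(1)] w(1) by (auto simp: \<mu>'_def)
  \<comment> \<open>Either \<open>v\<close> remains a witness, or \<open>v = w\<close> and its
    exponent has just reached that of \<open>\<kappa>\<close>. In the latter case
    \<open>\<mu>'\<close> divides \<open>\<kappa>\<close>, and equal degrees give equality.\<close>
  have cmp: "\<kappa> = \<mu>' \<or> \<kappa> \<succ>\<^sub>r \<mu>'"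
  proof (cases "count \<kappa> v < count \<mu>' v")
    case True
    have "gt u v" if "u \<noteq> v" "count \<kappa> u \<noteq> count \<mu>' u" for u
    proof -
      consider "u = x" | "u = w" | "u \<noteq> x" "u \<noteq> w" by blast
      then show ?thesis
      proof cases
        case 1
        then show ?thesis using x(4) vV by blast
      next
        case 2
        then show ?thesis using w(2)[OF vV] that(1) by blast
      next
        case 3
        then show ?thesis using v(2)[of u] that \<mu>' by simp
      qed
    qed
    then show ?thesis using True size' unfolding revlex_gt_def by blast
  next
    case False
    then have vw: "v = w" using v(1) \<mu>'[of v] \<open>v \<noteq> x\<close> by (auto split: if_splits)
    have "count \<mu>' u \<le> count \<kappa> u" for u
    proof -
      consider "u = x" | "u = w" | "u \<noteq> x" "u \<noteq> w" "count \<kappa> u = count \<mu> u" | "u \<noteq> x" "u \<noteq> w" "gt u w"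
        using v(2)[of u] vw by blast
      then show ?thesis
      proof cases
        case 1
        then show ?thesis using lt \<mu>' by simp
      next
        case 2
        then show ?thesis using False vw by simp
      next
        case 3
        then show ?thesis using \<mu>' by simp
      next
        case 4
        \<comment> \<open>\<open>w\<close> is the greatest variable of \<open>\<mu>\<close> in
          \<open>V\<close>, so nothing above it other than \<open>x\<close> occurs in
          \<open>\<mu>\<close>.\<close>
        have "u \<notin># \<mu>"
        proof
          assume "u \<in># \<mu>"
          then have "u \<in> set_mset \<mu> \<inter> V" using A[OF Suc.prems(1)] 4 by auto
          then have "gt w u" "u \<in> U" "w \<in> U" using w 4 x(2) by auto
          then show False using 4 gt_asym by blast
        qed
        then show ?thesis using \<mu>'[of u] 4 by (simp add: not_in_iff)
      qed
    qed
    then have "\<mu>' \<subseteq># \<kappa>" by (simp add: subseteq_mset_def)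
    then have "\<mu>' = \<kappa>" using size' by (metis mset_subset_size nless_le subset_mset.le_imp_less_or_eq)
    then show ?thesis by simp
  qed
  show ?case
  proof (cases "\<kappa> = \<mu>'")
    case True
    then show ?thesis using A' by blast
  next
    case False
    have "n = count \<kappa> x - count \<mu>' x" "count \<mu>' x \<le> count \<kappa> x"
      using Suc.hyps(2) lt \<mu>'[of x] by auto
    then show ?thesis using Suc.hyps(1)[OF _ A'] cmp False by blast
  qed
qed

text \<open>Outside parts are powers of \<open>x\<close>, so the fibers are degree truncations of
  \<open>D\<close>. Nesting involves only \<open>z = x\<close>, and multiplying by \<open>x\<close>
  does not affect membership apart from the degree bound.\<close>

lemma compressible_extend:
  assumes D: "finite D" "multicomplex D" "\<And>\<mu>. \<mu> \<in> D \<Longrightarrow> set_mset \<mu> \<subseteq> V" "macaulay D"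
    and x: "x \<notin> V"
  shows "compressible V (extend x d D)"
  unfolding compressible_def
proof (intro conjI ballI impI)
  fix \<mu> assume \<mu>: "\<mu> \<in> extend x d D"
  let ?\<nu> = "part_mon (-V) \<mu>"
  have "set_mset (part_mon (-{x}) \<mu>) \<subseteq> V" using \<mu> D(3) by (auto simp only: extend_def)
  then have "part_mon (-{x}) ?\<nu> = {#}" by (intro part_mon_disjoint) auto
  moreover have "part_mon (-{x}) \<eta> = \<eta>" if "set_mset \<eta> \<subseteq> V" for \<eta>
    using that x by (intro part_mon_id) auto
  ultimately have "fiber V (extend x d D) ?\<nu> = {\<eta> \<in> D. size \<eta> + size ?\<nu> \<le> d}"
    using D(3) by (auto simp: fiber_def extend_def)
  then show "macaulay (fiber V (extend x d D) ?\<nu>)"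
    using macaulay_truncate[OF D(1,4)] by simp
next
  fix \<mu> z \<kappa>
  assume *: "\<mu> \<in> extend x d D" "z \<in># \<mu>" "z \<notin> V" "\<kappa> \<in> extend x d D" "\<kappa> \<succ>\<^sub>r \<mu> - {#z#}"
  have "z = x"
  proof (rule ccontr)
    assume "z \<noteq> x"
    then have "z \<in># part_mon (-{x}) \<mu>" using *(2) by simp
    moreover have "part_mon (-{x}) \<mu> \<in> D" using *(1) by (simp add: extend_def)
    ultimately show False using D(3) *(3) by blast
  qed
  moreover have "Suc (size \<kappa>) = size \<mu>" using revlex_gt_size[OF *(5)] *(2) by (simp add: size_Suc_Diff1)
  ultimately show "add_mset z \<kappa> \<in> extend x d D" using *(1,4) by (simp add: extend_def)
qed

text \<open>Moving up in revlex inside \<open>{x, y}\<close> never raises the exponent of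
  \<open>y\<close>. As \<open>x\<close> is restricted by degree alone and \<open>D\<close> is closed
  under divisors, both conjuncts of \<open>compressible\<close> follow from this.\<close>

lemma compressible_extend_pair:
  assumes D: "finite D" "multicomplex D" and xy: "x \<in> U" "y \<in> U" "gt x y"
  shows "compressible {x, y} (extend x d D)"
  unfolding compressible_def
proof (intro conjI ballI impI)
  have neq: "x \<noteq> y" using xy gt_irrefl by blast
  have part: "part_mon (-{x}) \<eta> = replicate_mset (count \<eta> y) y" if "set_mset \<eta> \<subseteq> {x, y}" for \<eta>
    using that neq by (intro multiset_eqI) (auto simp: not_in_iff[symmetric])
  fix \<mu> assume \<mu>: "\<mu> \<in> extend x d D"
  let ?\<nu> = "part_mon (-{x, y}) \<mu>"
  show "macaulay (fiber {x, y} (extend x d D) ?\<nu>)"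
  proof (rule macaulay_two_variables[OF xy])
    show "finite (fiber {x, y} (extend x d D) ?\<nu>)"
      using D(1) by (intro finite_fiber finite_extend)
    show "\<And>\<mu>'. \<mu>' \<in> fiber {x, y} (extend x d D) ?\<nu> \<Longrightarrow> set_mset \<mu>' \<subseteq> {x, y}"
      by (simp add: fiber_def)
    fix \<eta> \<kappa> assume *: "\<eta> \<in> fiber {x, y} (extend x d D) ?\<nu>" "set_mset \<kappa> \<subseteq> {x, y}"
      "size \<kappa> = size \<eta>" "count \<kappa> y \<le> count \<eta> y"
    have "set_mset \<eta> \<subseteq> {x, y}" using *(1) by (simp add: fiber_def)
    then have "part_mon (-{x}) (\<kappa> + ?\<nu>) \<subseteq># part_mon (-{x}) (\<eta> + ?\<nu>)"
      using *(2,4) part by (simp add: subseteq_mset_def)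
    moreover have "part_mon (-{x}) (\<eta> + ?\<nu>) \<in> D"
      using *(1) by (simp only: fiber_def extend_def mem_Collect_eq)
    ultimately have "part_mon (-{x}) (\<kappa> + ?\<nu>) \<in> D"
      using multicomplexD[OF D(2)] by blast
    then show "\<kappa> \<in> fiber {x, y} (extend x d D) ?\<nu>"
      using * by (simp add: fiber_def extend_def)
  qed
next
  have neq: "x \<noteq> y" using xy gt_irrefl by blast
  fix \<mu> z \<kappa>
  assume *: "\<mu> \<in> extend x d D" "z \<in># \<mu>" "z \<notin> {x, y}" "\<kappa> \<in> extend x d D"
    "part_mon (-{x, y}) \<kappa> = part_mon (-{x, y}) (\<mu> - {#z#})" "\<kappa> \<succ>\<^sub>r \<mu> - {#z#}"
  have out: "count \<kappa> u = count (\<mu> - {#z#}) u" if "u \<notin> {x, y}" for u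
    using arg_cong[OF *(5), of "\<lambda>\<mu>. count \<mu> u"] that by simp
  obtain v where v: "count \<kappa> v < count (\<mu> - {#z#}) v"
    "\<And>u. u \<noteq> v \<Longrightarrow> count \<kappa> u \<noteq> count (\<mu> - {#z#}) u \<Longrightarrow> gt u v"
    using *(6) unfolding revlex_gt_def by blast
  have "v \<in> {x, y}" using v(1) out by force
  then have "count \<kappa> y \<le> count (\<mu> - {#z#}) y"
    using v gt_asym[OF xy] neq by (metis insertE less_imp_le order_refl singletonD)
  then have y: "count \<kappa> y \<le> count \<mu> y" by (auto split: if_splits)
  have "count (add_mset z \<kappa>) u \<le> count \<mu> u" if "u \<noteq> x" for u
    using y out[of u] *(2,3) that by (cases "u = y") (auto split: if_splits)
  then have "part_mon (-{x}) (add_mset z \<kappa>) \<subseteq># part_mon (-{x}) \<mu>"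
    by (simp only: subseteq_mset_def part_mon_simps(6)) (simp del: count_add_mset)
  moreover have "part_mon (-{x}) \<mu> \<in> D" using *(1) by (simp add: extend_def)
  ultimately have "part_mon (-{x}) (add_mset z \<kappa>) \<in> D" using multicomplexD[OF D(2)] by blast
  moreover have "Suc (size \<kappa>) = size \<mu>" using revlex_gt_size[OF *(6)] *(2) by (simp add: size_Suc_Diff1)
  ultimately show "add_mset z \<kappa> \<in> extend x d D" using *(1) by (simp add: extend_def)
qed

text \<open>The compressed set \<open>A\<close> and the segments \<open>K j\<close> have equal sizes
  in each degree. It remains to see that fewer elements of \<open>K\<close> than of \<open>A\<close>
  are multiples of \<open>x\<close>, or equally many, since these alone determine the
  shadow.\<close>

lemma macaulay_extend:
  assumes D: "finite D" "multicomplex D" "\<And>\<mu>. \<mu> \<in> D \<Longrightarrow> set_mset \<mu> \<subseteq> V" "macaulay D"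
    and x: "x \<in> U" "V \<subseteq> U" "x \<notin> V" "\<And>v. v \<in> V \<Longrightarrow> gt x v"
  shows "macaulay (extend x d D)"
  unfolding macaulay_def
proof (intro allI impI)
  define E where "E = extend x d D"
  fix M assume "M \<subseteq> extend x d D" and M0: "multicomplex M"
  then have ME0: "M \<subseteq> E" by (simp add: E_def)
  have finE: "finite E" and mcE: "multicomplex E"
    using D(1,2) by (simp_all add: E_def finite_extend multicomplex_extend)
  have E_vars: "set_mset \<mu> \<subseteq> insert x V" if "\<mu> \<in> E" for \<mu>
    using that D(3)[of "part_mon (-{x}) \<mu>"] by (auto simp: E_def extend_def)
  then have E_mono: "E \<subseteq> monomials" using x(1,2) unfolding monomials_def by blast
  have E_swap: "add_mset x (\<mu> - {#y#}) \<in> E" if "\<mu> \<in> E" "y \<in># \<mu>" for \<mu> y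
  proof -
    have "part_mon (-{x}) (add_mset x (\<mu> - {#y#})) \<subseteq># part_mon (-{x}) \<mu>" by simp
    moreover have "part_mon (-{x}) \<mu> \<in> D" using that(1) by (simp add: E_def extend_def)
    ultimately have "part_mon (-{x}) (add_mset x (\<mu> - {#y#})) \<in> D"
      using multicomplexD[OF D(2)] by blast
    then show ?thesis using that by (simp add: E_def extend_def size_Suc_Diff1)
  qed
  have "compressible W E" if "W \<in> insert V ((\<lambda>y. {x, y}) ` V)" for W
    using that compressible_extend[OF D x(3)] compressible_extend_pair[OF D(1,2) x(1)] x(2,4)
    unfolding E_def by blast
  from compress_family[OF finE E_mono mcE this ME0 M0]
  obtain A where A: "A \<subseteq> E" "multicomplex A" "F_vector A = F_vector M"
    and comp: "\<forall>W\<in>insert V ((\<lambda>y. {x, y}) ` V). compressed_on W E A"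
    by metis
  have comp_V: "compressed_on V E A" and comp_pair: "\<And>y. y \<in> V \<Longrightarrow> compressed_on {x, y} E A"
    using comp by simp_all
  have A_swap: "add_mset x (\<alpha> - {#y#}) \<in> A" if "\<alpha> \<in> A" "y \<in># \<alpha>" "y \<in> V" for \<alpha> y
  proof (rule compressed_onD[OF comp_pair[OF that(3)] that(1)])
    show "add_mset x (\<alpha> - {#y#}) \<succ>\<^sub>r \<alpha>" using that x by (intro swap_rgt) auto
  qed (use that A(1) E_swap in auto)

  define slice :: "'v multiset set \<Rightarrow> nat \<Rightarrow> 'v multiset set"
    where "slice = (\<lambda>K j. {\<mu> \<in> K. size \<mu> = j})"
  have slice_fin: "finite (slice K j)" if "K \<subseteq> E" for K j
    using that finE finite_subset unfolding slice_def by fastforce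
  have "\<exists>K\<subseteq>slice E j. initial (slice E j) K \<and> card K = card (slice A j)" for j
    using A(1) E_mono slice_fin[of E j]
    by (intro ex_initial card_mono) (auto simp: slice_def)
  then obtain K where K: "\<And>j. K j \<subseteq> slice E j" "\<And>j. initial (slice E j) (K j)"
    "\<And>j. card (K j) = card (slice A j)"
    by metis
  have finK: "finite (K j)" for j using K(1) slice_fin[of E j] finite_subset by blast
  define N where "N = {\<mu> \<in> E. \<mu> \<in> K (size \<mu>)}"
  have sliceN: "slice N j = K j" for j using K(1) by (auto simp: N_def slice_def)
  have K_swap: "add_mset x (\<mu> - {#y#}) \<in> K j" if "\<mu> \<in> K j" "y \<in># \<mu>" for \<mu> y j
  proof (cases "y = x")
    case True
    then show ?thesis using that by simp
  next
    case False
    have \<mu>: "\<mu> \<in> E" "size \<mu> = j" using that K(1) by (auto simp: slice_def)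
    then have "y \<in> V" using E_vars that(2) False by blast
    then have "add_mset x (\<mu> - {#y#}) \<succ>\<^sub>r \<mu>" using that x by (intro swap_rgt) auto
    moreover have "add_mset x (\<mu> - {#y#}) \<in> slice E j"
      using E_swap[OF \<mu>(1) that(2)] \<mu>(2) that(2) by (simp add: slice_def size_Suc_Diff1)
    ultimately show ?thesis using initialD[OF K(2) that(1)] by blast
  qed

  \<comment> \<open>If an \<open>x\<close>-free \<open>\<alpha>\<close> of \<open>A\<close> is
    missing from \<open>K j\<close>, all of \<open>K j\<close> lies above it. Swaps lead from
    \<open>\<alpha>\<close> to some \<open>\<beta>\<close> in \<open>A\<close> with the
    \<open>x\<close>-exponent of a given \<open>\<kappa>\<close>, and compression on
    \<open>V\<close> leads on to \<open>\<kappa>\<close>. Then \<open>K j\<close> would be a proper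
    subset of \<open>A\<close> in degree \<open>j\<close>, contradicting equal sizes.\<close>
  have free: "card {\<alpha> \<in> slice A j. x \<notin># \<alpha>} \<le> card {\<alpha> \<in> K j. x \<notin># \<alpha>}" for j
  proof (cases "{\<alpha> \<in> slice A j. x \<notin># \<alpha>} \<subseteq> K j")
    case True
    then show ?thesis using finK by (intro card_mono) auto
  next
    case False
    then obtain \<alpha> where \<alpha>: "\<alpha> \<in> A" "size \<alpha> = j" "x \<notin># \<alpha>" "\<alpha> \<notin> K j" by (auto simp: slice_def)
    have "\<kappa> \<in> A" if \<kappa>: "\<kappa> \<in> K j" for \<kappa>
    proof -
      have \<kappa>E: "\<kappa> \<in> E" "size \<kappa> = j" using \<kappa> K(1) by (auto simp: slice_def)
      have "\<not> \<alpha> \<succ>\<^sub>r \<kappa>" using initialD[OF K(2) \<kappa>] \<alpha> A(1) by (auto simp: slice_def)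
      moreover have "\<alpha> \<noteq> \<kappa>" using \<alpha> \<kappa> by blast
      moreover have "\<alpha> \<in> monomials" "\<kappa> \<in> monomials" using E_mono A(1) \<alpha>(1) \<kappa>E(1) by auto
      ultimately have "\<kappa> \<succ>\<^sub>r \<alpha>"
        using rgt_total[of \<alpha> \<kappa>] \<alpha>(2) \<kappa>E(2) by metis
      moreover have "count \<alpha> x \<le> count \<kappa> x" using \<alpha>(3) by (simp add: not_in_iff)
      moreover have "\<And>\<beta>. \<beta> \<in> A \<Longrightarrow> set_mset \<beta> \<subseteq> insert x V" using A(1) E_vars by blast
      ultimately obtain \<beta> where \<beta>: "\<beta> \<in> A" "count \<beta> x = count \<kappa> x" "\<kappa> = \<beta> \<or> \<kappa> \<succ>\<^sub>r \<beta>"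
        using reach_by_swaps[of x V A \<kappa> \<alpha>] x A_swap E_vars[OF \<kappa>E(1)] \<alpha>(1) by metis
      \<comment> \<open>Within \<open>E\<close> the only variable outside \<open>V\<close> is
        \<open>x\<close>, so equal exponents of \<open>x\<close> mean equal outside parts.\<close>
      have out: "part_mon (-V) \<rho> = part_mon {x} \<rho>" if "\<rho> \<in> E" for \<rho>
        using E_vars[OF that] x(3) by (intro multiset_eqI) (auto simp: not_in_iff[symmetric])
      have "part_mon (-V) \<kappa> = part_mon (-V) \<beta>"
        using \<beta> \<kappa>E A(1) out[of \<kappa>] out[of \<beta>] by (auto simp: part_mon_singleton)
      then show ?thesis using compressed_onD[OF comp_V \<beta>(1) \<kappa>E(1)] \<beta> by blast
    qed
    then have "K j \<subset> slice A j" using \<alpha> K(1) by (auto simp: slice_def)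
    then have "card (K j) < card (slice A j)" using slice_fin[OF A(1)] by (intro psubset_card_mono)
    then show ?thesis using K(3) by simp
  qed

  have split: "card {\<alpha> \<in> B. x \<in># \<alpha>} = card B - card {\<alpha> \<in> B. x \<notin># \<alpha>}" if "finite B" for B
  proof -
    have "{\<alpha> \<in> B. x \<in># \<alpha>} = B - {\<alpha> \<in> B. x \<notin># \<alpha>}" by blast
    then show ?thesis using that by (simp add: card_Diff_subset)
  qed
  have inj: "inj_on (\<lambda>\<alpha>. \<alpha> - {#x#}) {\<alpha> \<in> B. x \<in># \<alpha>}" for B
    by (rule inj_onI) (metis (mono_tags, lifting) insert_DiffM mem_Collect_eq)

  have shadow: "(\<lambda>\<alpha>. \<alpha> - {#x#}) ` {\<alpha> \<in> K (Suc j). x \<in># \<alpha>} \<subseteq> K j" for j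
  proof (rule initial_nested[where D = "slice E j", OF _ _ K(1) _ K(2)])
    let ?S = "(\<lambda>\<alpha>. \<alpha> - {#x#}) ` {\<alpha> \<in> K (Suc j). x \<in># \<alpha>}"
    show "slice E j \<subseteq> monomials" using E_mono by (auto simp: slice_def)
    show "?S \<subseteq> slice E j"
      using K(1)[of "Suc j"] multicomplexD[OF mcE] by (auto simp: slice_def size_Diff_singleton)
    show "finite ?S" using finK by simp
    show "\<And>\<mu>. \<mu> \<in> slice E j \<Longrightarrow> size \<mu> = j" by (simp add: slice_def)
    \<comment> \<open>Multiplication by \<open>x\<close> preserves revlex, and it stays in
      \<open>E\<close> because \<open>Suc j\<close> is a degree occurring there.\<close>
    show "initial (slice E j) ?S"
      unfolding initial_def
    proof (intro ballI impI)
      fix \<sigma> \<kappa> assume "\<sigma> \<in> ?S" and \<kappa>: "\<kappa> \<in> slice E j" "\<kappa> \<succ>\<^sub>r \<sigma>"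
      then obtain \<alpha> where \<alpha>: "\<alpha> \<in> K (Suc j)" "x \<in># \<alpha>" "\<sigma> = \<alpha> - {#x#}" by blast
      have "Suc j \<le> d" using \<alpha>(1) K(1)[of "Suc j"] by (auto simp: slice_def E_def extend_def)
      then have "add_mset x \<kappa> \<in> slice E (Suc j)" using \<kappa>(1) by (simp add: slice_def E_def extend_def)
      moreover have "add_mset x \<kappa> \<succ>\<^sub>r \<alpha>"
        using \<alpha> \<kappa>(2) revlex_gt_add_right[of gt \<kappa> "{#x#}" \<sigma>] by simp
      ultimately have "add_mset x \<kappa> \<in> K (Suc j)" using initialD[OF K(2) \<alpha>(1)] by blast
      then show "\<kappa> \<in> ?S" by (intro image_eqI[of _ _ "add_mset x \<kappa>"]) auto
    qed
    have "card ?S = card {\<alpha> \<in> K (Suc j). x \<in># \<alpha>}" using inj by (rule card_image)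
    \<comment> \<open>The totals agree, so at least as many \<open>x\<close>-free monomials in
      \<open>K\<close> means at most as many multiples of \<open>x\<close>.\<close>
    also have "\<dots> \<le> card {\<alpha> \<in> slice A (Suc j). x \<in># \<alpha>}"
      using split[OF finK] split[OF slice_fin[OF A(1)]] free[of "Suc j"] K(3)[of "Suc j"] by simp
    also have "\<dots> = card ((\<lambda>\<alpha>. \<alpha> - {#x#}) ` {\<alpha> \<in> slice A (Suc j). x \<in># \<alpha>})"
      using inj by (rule card_image[symmetric])
    also have "\<dots> \<le> card (slice A j)"
      using slice_fin[OF A(1)] multicomplexD[OF A(2)]
      by (intro card_mono) (auto simp: slice_def size_Diff_singleton)
    finally show "card ?S \<le> card (K j)" using K(3) by simp
  qed

  have "multicomplex N"
  proof (rule multicomplexI_remove1)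
    fix \<mu> z assume \<mu>: "\<mu> \<in> N" and z: "z \<in># \<mu>"
    obtain j where j: "size \<mu> = Suc j" "size (\<mu> - {#z#}) = j"
      using z by (metis size_Suc_Diff1)
    \<comment> \<open>Division by \<open>z\<close> is traded for division by \<open>x\<close>: first
      replace \<open>z\<close> by \<open>x\<close>, which stays in the segment, then cancel
      \<open>x\<close>.\<close>
    have "add_mset x (\<mu> - {#z#}) \<in> K (Suc j)"
      using \<mu> z j K_swap by (auto simp: N_def)
    then have "add_mset x (\<mu> - {#z#}) \<in> {\<alpha> \<in> K (Suc j). x \<in># \<alpha>}" by simp
    from subsetD[OF shadow imageI[OF this]] have "\<mu> - {#z#} \<in> K j" by simp
    then show "\<mu> - {#z#} \<in> N"
      using j(2) \<mu> multicomplexD[OF mcE] by (auto simp: N_def)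
  qed
  moreover have "initial E N"
    using K(2) revlex_gt_size unfolding initial_def N_def slice_def by fastforce
  moreover have "F_vector N = F_vector M"
  proof
    fix j
    show "F_vector N j = F_vector M j"
      unfolding A(3)[symmetric] F_vector_def using K(3) sliceN by (simp add: slice_def)
  qed
  ultimately show "\<exists>N\<subseteq>extend x d D. multicomplex N \<and> initial (extend x d D) N \<and> F_vector N = F_vector M"
    unfolding E_def by (intro exI[of _ N]) (auto simp: N_def E_def)
qed

end

section \<open>Compression on two blocks of variables\<close>

context revlex_order
begin

lemma multicomplex_monomials: "multicomplex {\<mu>. set_mset \<mu> \<subseteq> V \<and> size \<mu> \<le> d}"
  unfolding multicomplex_def by (auto dest: set_mset_mono size_mset_mono)

text \<open>This is Macaulay's theorem in bounded degree, built up from the least variable by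
  \<open>macaulay_extend\<close>.\<close>

lemma macaulay_all_monomials:
  assumes "finite Y" "Y \<subseteq> U"
  shows "macaulay {\<mu>. set_mset \<mu> \<subseteq> Y \<and> size \<mu> \<le> c}"
  using assms
proof (induction Y rule: greatest_induct)
  case empty
  have "initial {\<mu>. set_mset \<mu> \<subseteq> {} \<and> size \<mu> \<le> c} M" for M
    by (auto simp: initial_def revlex_gt_def)
  then show ?case unfolding macaulay_def by blast
next
  case (insert x V)
  have "extend x c {\<mu>. set_mset \<mu> \<subseteq> V \<and> size \<mu> \<le> c} = {\<mu>. set_mset \<mu> \<subseteq> insert x V \<and> size \<mu> \<le> c}"
    by (auto simp: extend_def size_part_mon_le)
  moreover have "macaulay (extend x c {\<mu>. set_mset \<mu> \<subseteq> V \<and> size \<mu> \<le> c})"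
    using insert assms(2) by (intro macaulay_extend finite_monomials multicomplex_monomials) auto
  ultimately show ?case by simp
qed

text \<open>For empty \<open>T\<close> the block bound is just a second degree bound. The variables
  of \<open>T\<close> exceed those of \<open>Y\<close> and do not enter the block bound, so each is
  added by \<open>extend\<close>.\<close>

lemma macaulay_bounded_block:
  fixes a :: int
  assumes T: "finite T" "T \<subseteq> U" and Y: "finite Y" "Y \<subseteq> U" and "\<And>t y. t \<in> T \<Longrightarrow> y \<in> Y \<Longrightarrow> gt t y"
  shows "macaulay {\<mu>. set_mset \<mu> \<subseteq> T \<union> Y \<and> size \<mu> \<le> d \<and> int (size (part_mon Y \<mu>)) \<le> a}"
  using T
proof (induction T rule: greatest_induct)
  case empty
  show ?case
  \<comment> \<open>A negative bound excludes even the monomial 1, whereas \<open>nat a = 0\<close>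
    would admit it.\<close>
  proof (cases "a < 0")
    case True
    then have "{\<mu>. set_mset \<mu> \<subseteq> {} \<union> Y \<and> size \<mu> \<le> d \<and> int (size (part_mon Y \<mu>)) \<le> a} = {}" by auto
    then show ?thesis unfolding macaulay_def initial_def by auto
  next
    case False
    then have "{\<mu>. set_mset \<mu> \<subseteq> {} \<union> Y \<and> size \<mu> \<le> d \<and> int (size (part_mon Y \<mu>)) \<le> a} =
        {\<mu>. set_mset \<mu> \<subseteq> Y \<and> size \<mu> \<le> min d (nat a)}"
      by (auto simp: part_mon_id)
    then show ?thesis using macaulay_all_monomials[OF Y, of "min d (nat a)"] by (simp only:)
  qed
next
  case (insert x V)
  let ?D = "{\<mu>. set_mset \<mu> \<subseteq> V \<union> Y \<and> size \<mu> \<le> d \<and> int (size (part_mon Y \<mu>)) \<le> a}"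
  have xU: "x \<in> U" and xY: "x \<notin> Y" using insert.hyps(2) T(2) assms(5) gt_irrefl by blast+
  have Y_part: "part_mon Y (part_mon (-{x}) \<mu>) = part_mon Y \<mu>" for \<mu>
    using xY by (intro multiset_eqI) auto
  have "extend x d ?D =
      {\<mu>. set_mset \<mu> \<subseteq> insert x V \<union> Y \<and> size \<mu> \<le> d \<and> int (size (part_mon Y \<mu>)) \<le> a}"
    by (auto simp: extend_def Y_part size_part_mon_le)
  moreover have "macaulay (extend x d ?D)"
  proof (rule macaulay_extend[where V = "V \<union> Y"])
    have "finite {\<mu>. set_mset \<mu> \<subseteq> V \<union> Y \<and> size \<mu> \<le> d}"
      using insert.hyps(1) Y(1) by (intro finite_monomials) auto
    then show "finite ?D" by (rule rev_finite_subset) auto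
    show "multicomplex ?D"
      unfolding multicomplex_def
    proof clarify
      fix \<mu> \<nu> assume *: "set_mset \<mu> \<subseteq> V \<union> Y" "size \<mu> \<le> d" "int (size (part_mon Y \<mu>)) \<le> a" "\<nu> \<subseteq># \<mu>"
      have "size (part_mon Y \<nu>) \<le> size (part_mon Y \<mu>)"
        using *(4) by (intro size_mset_mono part_mon_mono)
      then show "set_mset \<nu> \<subseteq> V \<union> Y \<and> size \<nu> \<le> d \<and> int (size (part_mon Y \<nu>)) \<le> a"
        using * set_mset_mono[OF *(4)] size_mset_mono[OF *(4)] by auto
    qed
  qed (use insert T(2) Y(2) assms(5) xU xY in auto)
  ultimately show ?case by simp
qed

end

section \<open>The ambient set and the passage to a (0)-compressed multicomplex\<close>

lemma multicomplex_S_mon: "multicomplex (S_mon d m X a)"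
  unfolding multicomplex_def
proof (intro ballI allI impI)
  fix \<mu> \<nu> assume *: "\<mu> \<in> S_mon d m X a" "\<nu> \<subseteq># \<mu>"
  have "int (size (part_mon (X i) \<nu>)) \<le> a i" if "i \<in> {1..m}" for i
  proof -
    have "size (part_mon (X i) \<nu>) \<le> size (part_mon (X i) \<mu>)"
      using *(2) by (intro size_mset_mono part_mon_mono)
    moreover have "int (size (part_mon (X i) \<mu>)) \<le> a i" using *(1) that by (simp add: S_mon_def)
    ultimately show ?thesis by linarith
  qed
  then show "\<nu> \<in> S_mon d m X a"
    using *(1) set_mset_mono[OF *(2)] size_mset_mono[OF *(2)] by (auto simp: S_mon_def)
qed

theorem theorem4p1:
  fixes X :: "nat \<Rightarrow> 'v set" and m d :: nat and a :: "nat \<Rightarrow> int"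
    and gt :: "'v \<Rightarrow> 'v \<Rightarrow> bool" and M :: "'v multiset set"
  assumes "\<And>i. i \<le> m \<Longrightarrow> finite (X i)"
    and "disjoint_family_on X {0..m}"
    and "irreflp_on (all_vars m X) gt"
    and "transp_on (all_vars m X) gt"
    and "totalp_on (all_vars m X) gt"
    and "\<And>i j x y. i < j \<Longrightarrow> j \<le> m \<Longrightarrow> x \<in> X i \<Longrightarrow> y \<in> X j \<Longrightarrow> gt x y"
    and "multicomplex M"
    and "M \<subseteq> S_mon d m X a"
  shows "\<exists>M'. multicomplex M' \<and> M' \<subseteq> S_mon d m X a \<and>
              compressed_0 d m X a gt M' \<and> F_vector M' = F_vector M"
proof -
  let ?U = "all_vars m X" and ?S = "S_mon d m X a"
  interpret revlex_order ?U gt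
    using assms(3-5) by unfold_locales
  have finU: "finite ?U" using assms(1) by (auto simp: all_vars_def)
  have finS: "finite ?S"
    by (rule finite_subset[OF _ finite_monomials[OF finU, of d]]) (auto simp: S_mon_def)
  have S_mono: "?S \<subseteq> monomials" by (auto simp: S_mon_def monomials_def)
  have disj: "X i \<inter> X j = {}" if "i \<le> m" "j \<le> m" "i \<noteq> j" for i j
    using assms(2) that by (auto simp: disjoint_family_on_def)
  have X_sub: "X i \<subseteq> ?U" if "i \<le> m" for i using that by (auto simp: all_vars_def)

  have comp: "compressible (X 0 \<union> X i) ?S" if i: "i \<in> {1..m}" for i
    unfolding compressible_def
  proof (intro conjI ballI impI)
    let ?W = "X 0 \<union> X i"
    have other: "part_mon (X j) \<eta> = {#}" if "set_mset \<eta> \<subseteq> ?W" "j \<in> {1..m}" "j \<noteq> i" for \<eta> j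
      using that disj[of j 0] disj[of j i] i by (intro part_mon_disjoint) auto
    {
      fix \<mu> assume \<mu>: "\<mu> \<in> ?S"
      let ?\<nu> = "part_mon (-?W) \<mu>"
      have \<nu>: "?\<nu> \<in> ?S"
        using \<mu> multicomplexD[OF multicomplex_S_mon] part_mon_partition[of ?W \<mu>]
        by (metis mset_subset_eq_add_right)
      have \<nu>i: "part_mon (X i) ?\<nu> = {#}" by (intro part_mon_disjoint) auto
      have "?W \<subseteq> ?U" using X_sub i by auto
      \<comment> \<open>\<open>\<eta>\<close> contributes nothing to the blocks other than
        \<open>i\<close>, whose bounds already hold for the outside part; the outside part
        contributes nothing to block \<open>i\<close>.\<close>
      have mem: "\<eta> + ?\<nu> \<in> ?S \<longleftrightarrow> size \<eta> + size ?\<nu> \<le> d \<and> int (size (part_mon (X i) \<eta>)) \<le> a i"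
        if \<eta>: "set_mset \<eta> \<subseteq> ?W" for \<eta>
      proof -
        have "int (size (part_mon (X j) (\<eta> + ?\<nu>))) \<le> a j \<longleftrightarrow> j \<noteq> i \<or> int (size (part_mon (X i) \<eta>)) \<le> a i"
          if "j \<in> {1..m}" for j
          using that \<nu> other[OF \<eta> that] \<nu>i by (cases "j = i") (simp_all only: S_mon_def part_mon_simps(2), auto)
        moreover have "set_mset (\<eta> + ?\<nu>) \<subseteq> ?U"
          using \<eta> \<nu> \<open>?W \<subseteq> ?U\<close> by (auto simp: S_mon_def)
        ultimately show ?thesis using i by (auto simp only: S_mon_def mem_Collect_eq size_union)
      qed
      have "size ?\<nu> \<le> d" using \<nu> by (simp add: S_mon_def)
      have "fiber ?W ?S ?\<nu> = {\<eta>. set_mset \<eta> \<subseteq> X 0 \<union> X i \<and> size \<eta> \<le> d - size ?\<nu> \<and>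
          int (size (part_mon (X i) \<eta>)) \<le> a i}"
        unfolding fiber_def le_diff_conv2[OF \<open>size ?\<nu> \<le> d\<close>] using mem by blast
      moreover have "macaulay {\<eta>. set_mset \<eta> \<subseteq> X 0 \<union> X i \<and> size \<eta> \<le> d - size ?\<nu> \<and>
          int (size (part_mon (X i) \<eta>)) \<le> a i}"
        using i assms(1) X_sub assms(6)[of 0 i] by (intro macaulay_bounded_block) auto
      ultimately show "macaulay (fiber ?W ?S ?\<nu>)" by simp
    }
    fix \<mu> z \<kappa>
    assume *: "\<mu> \<in> ?S" "z \<in># \<mu>" "z \<notin> ?W" "\<kappa> \<in> ?S"
      "part_mon (-?W) \<kappa> = part_mon (-?W) (\<mu> - {#z#})" "\<kappa> \<succ>\<^sub>r \<mu> - {#z#}"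
    have "size (add_mset z \<kappa>) = size \<mu>"
      using revlex_gt_size[OF *(6)] *(2) by (simp add: size_Suc_Diff1)
    \<comment> \<open>As \<open>z\<close> lies outside \<open>X 0 \<union> X i\<close>, block
      \<open>i\<close> is that of \<open>\<kappa>\<close>. Every other bounded block agrees with
      that of \<open>\<mu>\<close>, since \<open>z\<close> is restored there.\<close>
    moreover have "int (size (part_mon (X j) (add_mset z \<kappa>))) \<le> a j" if j: "j \<in> {1..m}" for j
    proof (cases "j = i")
      case True
      then show ?thesis using *(3,4) j by (simp add: S_mon_def)
    next
      case False
      have "X j \<subseteq> -?W" using j i False disj[of j 0] disj[of j i] by auto
      have "count (add_mset z \<kappa>) u = count \<mu> u" if "u \<in> X j" for u
      proof -
        have "u \<in> -?W" using that \<open>X j \<subseteq> -?W\<close> by blast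
        then have "count \<kappa> u = count (\<mu> - {#z#}) u"
          using arg_cong[OF *(5), of "\<lambda>\<mu>. count \<mu> u"] by (simp only: part_mon_simps(6) if_True)
        then show ?thesis using *(2) by auto
      qed
      then have "part_mon (X j) (add_mset z \<kappa>) = part_mon (X j) \<mu>"
        by (intro multiset_eqI) (simp only: part_mon_simps(6) cong: if_cong)
      then show ?thesis using *(1) j by (simp only: S_mon_def mem_Collect_eq)
    qed
    moreover have "z \<in> ?U" using *(1,2) by (auto simp: S_mon_def)
    ultimately show "add_mset z \<kappa> \<in> ?S"
      using *(1,4) by (simp only: S_mon_def mem_Collect_eq) auto
  qed

  have "\<exists>N\<subseteq>?S. multicomplex N \<and> F_vector N = F_vector M \<and>
      (\<forall>W\<in>(\<lambda>i. X 0 \<union> X i) ` {1..m}. compressed_on W ?S N)"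
    using comp assms(7,8) by (intro compress_family finS S_mono multicomplex_S_mon) auto
  then obtain N where N: "N \<subseteq> ?S" "multicomplex N" "F_vector N = F_vector M"
    and N_comp: "\<And>i. i \<in> {1..m} \<Longrightarrow> compressed_on (X 0 \<union> X i) ?S N"
    by blast
  have "compressed_0i d m X a gt i N" if i: "i \<in> {1..m}" for i
    unfolding compressed_0i_def
  proof (intro ballI impI)
    let ?W = "X 0 \<union> X i"
    fix \<mu> \<mu>' assume *: "\<mu> \<in> N" "\<mu>' \<in> ?S" "part_mon (?U - ?W) \<mu>' = part_mon (?U - ?W) \<mu>"
      "revlex_gt gt (part_mon ?W \<mu>') (part_mon ?W \<mu>)"
    \<comment> \<open>\<open>compressed_0i\<close> takes the complement inside the variables and
      \<open>compressed_on\<close> the full complement; on ambient monomials both give the same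
      part.\<close>
    have "part_mon (?U - ?W) \<rho> = part_mon (-?W) \<rho>" if "\<rho> \<in> ?S" for \<rho>
    proof -
      have "set_mset \<rho> \<subseteq> ?U" using that by (simp add: S_mon_def)
      then show ?thesis by (intro multiset_eqI) (auto simp: not_in_iff[symmetric])
    qed
    then have out: "part_mon (-?W) \<mu>' = part_mon (-?W) \<mu>" using *(1-3) N(1) by auto
    \<comment> \<open>Multiplying both \<open>?W\<close>-parts by the common outside part restores
      the comparison of whole monomials.\<close>
    have "\<mu>' \<succ>\<^sub>r \<mu>"
      using *(4) revlex_gt_add_right[of gt "part_mon ?W \<mu>'" "part_mon (-?W) \<mu>" "part_mon ?W \<mu>"]
        part_mon_partition[of ?W] out by metis
    then show "\<mu>' \<in> N" using compressed_onD[OF N_comp[OF i] *(1,2) out] by blast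
  qed
  then show ?thesis using N unfolding compressed_0_def by blast
qed

end
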